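(* Let $G$ be an undirected connected graph with $m$ edges and positive edge weights, with weighted cutset projection $\mathcal{P}_{\mathrm{cut}}\in\mathbb{R}^{m\times m}$ and weighted cycle projection $\mathcal{P}_{\mathrm{cyc}}\in\mathbb{R}^{m\times m}$. Let $\eta\in\mathbb{R}^m$ satisfy $\|\eta\|_\infty<h(\|\mathcal{P}_{\mathrm{cyc}}\|_\infty)$ and define $\gamma^*\in[0,\frac{\pi}{2})$ by $$\gamma^*=\arccos\left(\frac{h^{-1}(\|\eta\|_\infty)}{h^{-1}(\|\eta\|_\infty)+1}\right).$$ Let $\mathcal{F}_{\mathbb{C}}:\mathrm{D}^{\mathbb{C}}_m(\mathbf{0}_m,\sin(\gamma^* ))\to\mathbb{C}^m$ be the complex edge balance map $\mathcal{F}_{\mathbb{C}}(\phi)=\mathcal{P}_{\mathrm{cut}}\phi+\mathcal{P}_{\mathrm{cyc}}\arcsin(\phi)$. Then the following statements hold: (i) there exists a unique $\phi^*\in\mathrm{D}^{\mathbb{C}}_m(\mathbf{0}_m,\sin(\gamma^* ))$ such that $\mathcal{F}_{\mathbb{C}}(\phi^* )=\eta$; (ii) writing $V$ for the preimage of $\mathrm{D}^{\mathbb{C}}_m(\mathbf{0}_m,\|\eta\|_\infty)$ under $\mathcal{F}_{\mathbb{C}}$, there exists a holomorphic map $\mathcal{F}_{\mathbb{C}}^{-1}:\mathrm{D}^{\mathbb{C}}_m(\mathbf{0}_m,\|\eta\|_\infty)\to V$ such that $$\mathcal{F}_{\mathbb{C}}^{-1}\circ\mathcal{F}_{\mathbb{C}}(\phi)=\phi\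 \text{ for all }\phi\in V,\qquad \mathcal{F}_{\mathbb{C}}\circ\mathcal{F}_{\mathbb{C}}^{-1}(\xi)=\xi\ \text{ for all }\xi\in\mathrm{D}^{\mathbb{C}}_m(\mathbf{0}_m,\|\eta\|_\infty);$$ (iii) the power series $$\sum_{i=0}^\infty A_{2i+1}(\eta)=A_1(\eta)+A_3(\eta)+A_5(\eta)+\cdots$$ converges strongly to $\mathcal{F}_{\mathbb{C}}^{-1}(\eta)$, where, for every integer $i\ge0$, the term $A_{2i+1}(\eta)$ is a homogeneous polynomial of order $2i+1$ in $\eta$, defined iteratively by $A_1(\eta)=\eta$ and, for $i\ge1$, $$A_{2i+1}(\eta)=-\mathcal{P}_{\mathrm{cyc}}\left(\sum_{k=1}^i\frac{(2k-1)!!}{(2k)!!\,(2k+1)}\sum_{\substack{\text{odd }\alpha_1,\dots,\alpha_{2k+1}\text{ s.t.}\\ \alpha_1+\cdots+\alpha_{2k+1}=2i+1}}A_{\alpha_1}(\eta)\circ\cdots\circ A_{\alpha_{2k+1}}(\eta)\right).$$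
   Context: Graph notation: $G$ has $n$ nodes, $m$ edges, no self-loops, and symmetric weights $a_{ij}=a_{ji}>0$ on edges. $B\in\mathbb{R}^{n\times m}$ is the (oriented) incidence matrix for an arbitrary fixed orientation, $\mathcal{A}\in\mathbb{R}^{m\times m}$ the diagonal matrix of edge weights, $L=B\mathcal{A}B^\top$ the Laplacian, $L^\dagger$ its Moore–Penrose pseudoinverse. $\mathcal{P}_{\mathrm{cut}}=B^\top L^\dagger B\mathcal{A}$ (the oblique projection onto $\mathrm{Img}(B^\top)$ parallel to $\mathrm{Ker}(B\mathcal{A})$) and $\mathcal{P}_{\mathrm{cyc}}=I_m-B^\top L^\dagger B\mathcal{A}$. For matrices, $\|\cdot\|_\infty$ is the norm induced by the vector norm $\|\cdot\|_\infty$. Polydisks: for $r\ge0$ and $\mathbf{z}\in\mathbb{C}^m$, $\mathrm{D}^{\mathbb{C}}_m(\mathbf{z},r)=\{\mathbf{w}\in\mathbb{C}^m : \|\mathbf{z}-\mathbf{w}\|_\infty\le r\}$. $\mathbf{0}_m$ is the zero vector. For $\mathbf{x}\in\mathbb{C}^m$ with $\|\mathbf{x}\|_\infty\le1$, $\arcsin(\mathbf{x})$ is taken componentwise, with $\arcsin(r)=\sum_{i=0}^\infty\frac{(2i-1)!!}{(2i)!!\,(2i+1)}r^{2i+1}$. Double factorial: $N!!=\prod_{k=0}^{\lceil N/2\rceil-1}(N-2k)$, with empty products equal to $1$ (so $(-1)!!=0!!=1$). The symbol $\circ$ between vectors denotes the entrywise (Hadamard) product; between maps it denotes composition. The inner sum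 in the recursion is over ordered tuples of odd positive integers $(\alpha_1,\dots,\alpha_{2k+1})$. The function $h:\mathbb{R}_{\ge0}\to\mathbb{R}$ is $$h(x)=(x+1)\sqrt{1-\left(\tfrac{x}{x+1}\right)^2}-x\arccos\left(\tfrac{x}{x+1}\right);$$ it is continuous and strictly decreasing with range $(0,1]$, and $h^{-1}:(0,1]\to\mathbb{R}_{\ge0}$ denotes its inverse. When $\|\eta\|_\infty=0$, the formula for $\gamma^*$ is read as its limiting value $\gamma^*=0$. Strong convergence: a power series $\sum_{\nu\in(\mathbb{Z}_{\ge0})^m}a_\nu(x-x_0)^\nu$ (multi-index notation) converges strongly at $x$ if all rearrangements of its terms converge at $x$; the series in (iii) is regarded as a power series in the components of $\eta$ around $\mathbf{0}_m$. *)

theory Defs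
  imports "HOL-Analysis.Analysis"
begin

text \<open>
  A graph on the vertex type \<open>'n\<close> is a set \<open>E\<close> of two-element vertex sets, with weights
  \<open>a i j\<close>; the values of \<open>a\<close> off the edges are irrelevant.
\<close>

definition weighted_graph :: "'n set set \<Rightarrow> ('n \<Rightarrow> 'n \<Rightarrow> real) \<Rightarrow> bool" where
  "weighted_graph E a \<longleftrightarrow>
     (\<forall>e\<in>E. \<exists>i j. i \<noteq> j \<and> e = {i, j}) \<and>
     (\<forall>i j. a i j = a j i) \<and>
     (\<forall>i j. {i, j} \<in> E \<longrightarrow> a i j > 0)"

definition connected_graph :: "'n set set \<Rightarrow> bool" where
  "connected_graph E \<longleftrightarrow> (\<forall>i j. (i, j) \<in> {(u, v). {u, v} \<in> E}\<^sup>*)"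

text \<open>
  The edges are numbered by the type \<open>'m\<close> (so \<open>m = CARD('m)\<close>), and edge \<open>e\<close> is oriented
  from \<open>src e\<close> to \<open>tgt e\<close>.
\<close>

definition edge_orientation :: "'n set set \<Rightarrow> ('m \<Rightarrow> 'n) \<Rightarrow> ('m \<Rightarrow> 'n) \<Rightarrow> bool" where
  "edge_orientation E src tgt \<longleftrightarrow> bij_betw (\<lambda>e. {src e, tgt e}) UNIV E"

definition incidence_matrix :: "('m::finite \<Rightarrow> 'n::finite) \<Rightarrow> ('m \<Rightarrow> 'n) \<Rightarrow> real^'m^'n" where
  "incidence_matrix src tgt =
     (\<chi> i e. if i = src e then 1 else if i = tgt e then -1 else 0)"

definition weight_matrix ::
    "('n \<Rightarrow> 'n \<Rightarrow> real) \<Rightarrow> ('m::finite \<Rightarrow> 'n) \<Rightarrow> ('m \<Rightarrow> 'n) \<Rightarrow> real^'m^'m" where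
  "weight_matrix a src tgt = (\<chi> e e'. if e = e' then a (src e) (tgt e) else 0)"

definition is_pseudoinverse :: "real^'n^'m \<Rightarrow> real^'m^'n \<Rightarrow> bool" where
  "is_pseudoinverse A X \<longleftrightarrow>
     A ** X ** A = A \<and> X ** A ** X = X \<and>
     transpose (A ** X) = A ** X \<and> transpose (X ** A) = X ** A"

definition pseudoinverse :: "real^'n^'m \<Rightarrow> real^'m^'n" where
  "pseudoinverse A = (THE X. is_pseudoinverse A X)"

text \<open>Below, \<open>B\<close> is the incidence matrix and \<open>W\<close> the diagonal matrix of edge weights.\<close>

definition laplacian :: "real^'m^'n \<Rightarrow> real^'m^'m \<Rightarrow> real^'n^'n" where
  "laplacian B W = B ** W ** transpose B"

definition cutset_projection :: "real^'m^'n \<Rightarrow> real^'m^'m \<Rightarrow> real^'m^'m" where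
  "cutset_projection B W = transpose B ** pseudoinverse (laplacian B W) ** B ** W"

definition cycle_projection :: "real^'m^'n \<Rightarrow> real^'m^'m \<Rightarrow> real^'m^'m" where
  "cycle_projection B W = mat 1 - cutset_projection B W"

text \<open>
  The library's \<^const>\<open>infnorm\<close> on \<^typ>\<open>complex^'m\<close> is the maximum over the real coordinates (real
  and imaginary parts), not over the moduli of the entries, so it is not used here.
\<close>

definition vec_norm_inf :: "'a::real_normed_vector^'m \<Rightarrow> real" where
  "vec_norm_inf x = Max (range (\<lambda>i. norm (x $ i)))"

definition mat_norm_inf :: "real^'n^'m \<Rightarrow> real" where
  "mat_norm_inf A = (SUP x\<in>{x. vec_norm_inf x = 1}. vec_norm_inf (A *v x))"

definition polydisk :: "complex^'m \<Rightarrow> real \<Rightarrow> (complex^'m) set" where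
  "polydisk z r = {w. vec_norm_inf (z - w) \<le> r}"

definition cvec :: "real^'m \<Rightarrow> complex^'m" where
  "cvec x = (\<chi> i. complex_of_real (x $ i))"

definition cmat :: "real^'n^'m \<Rightarrow> complex^'n^'m" where
  "cmat A = (\<chi> i j. complex_of_real (A $ i $ j))"

text \<open>Defined on the integers, because \<open>(-1)!! = 1\<close> is needed.\<close>

definition double_fact :: "int \<Rightarrow> int" where
  "double_fact N = (\<Prod>k = 0..\<lceil>real_of_int N / 2\<rceil> - 1. N - 2 * k)"

definition arcsin_coeff :: "nat \<Rightarrow> real" where
  "arcsin_coeff i =
     real_of_int (double_fact (2 * int i - 1)) /
     (real_of_int (double_fact (2 * int i)) * (2 * real i + 1))"

definition arcsin_series :: "complex \<Rightarrow> complex" where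
  "arcsin_series z = (\<Sum>i. complex_of_real (arcsin_coeff i) * z ^ (2 * i + 1))"

definition edge_balance :: "real^'m^'m \<Rightarrow> real^'m^'m \<Rightarrow> complex^'m \<Rightarrow> complex^'m" where
  "edge_balance Pcut Pcyc \<phi> = cmat Pcut *v \<phi> + cmat Pcyc *v (\<chi> e. arcsin_series (\<phi> $ e))"

definition h :: "real \<Rightarrow> real" where
  "h x = (x + 1) * sqrt (1 - (x / (x + 1))\<^sup>2) - x * arccos (x / (x + 1))"

definition h_inv :: "real \<Rightarrow> real" where
  "h_inv = the_inv_into {0..} h"

text \<open>\<^term>\<open>h_inv\<close> is meaningful on \<open>(0,1]\<close> only; at 0 the limiting value 0 is used.\<close>

definition gamma_star :: "real \<Rightarrow> real" where
  "gamma_star r = (if r = 0 then 0 else arccos (h_inv r / (h_inv r + 1)))"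

text \<open>
  On a set that need not be open, holomorphic means that the map extends to a holomorphic map on an
  open neighbourhood. Multiplication by a complex matrix \<open>J\<close> makes the derivative complex linear.
\<close>

definition holomorphic_vec_on ::
    "(complex^'m \<Rightarrow> complex^'k) \<Rightarrow> (complex^'m) set \<Rightarrow> bool" where
  "holomorphic_vec_on f S \<longleftrightarrow>
     (\<exists>U g. open U \<and> S \<subseteq> U \<and> (\<forall>z\<in>S. g z = f z) \<and>
       (\<forall>z\<in>U. \<exists>J :: complex^'m^'k. (g has_derivative (\<lambda>v. J *v v)) (at z)))"

definition odd_tuples :: "nat \<Rightarrow> nat \<Rightarrow> nat list set" where
  "odd_tuples l n = {\<alpha>s. length \<alpha>s = l \<and> (\<forall>\<alpha>\<in>set \<alpha>s. odd \<alpha>) \<and> sum_list \<alpha>s = n}"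

lemma odd_tuples_less:
  assumes "k \<ge> 1" and "\<alpha>s \<in> odd_tuples (2 * k + 1) n" and "\<alpha> \<in> set \<alpha>s"
  shows "\<alpha> < n"
proof -
  from assms(3) obtain xs ys where s: "\<alpha>s = xs @ \<alpha> # ys"
    by (meson split_list)
  with assms have "xs \<noteq> [] \<or> ys \<noteq> []"
    by (auto simp: odd_tuples_def)
  then obtain b where b: "b \<in> set xs \<union> set ys"
    by (cases xs; cases ys) auto
  then have "odd b"
    using assms(2) s by (auto simp: odd_tuples_def)
  then have "b > 0"
    by (rule odd_pos)
  moreover have "b \<le> sum_list xs + sum_list ys"
    using b by (auto intro: member_le_sum_list trans_le_add1 trans_le_add2)
  ultimately show ?thesis
    using assms(2) s by (auto simp: odd_tuples_def)
qed

text \<open>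
  \<open>series_term P n\<close> is the map \<open>A\<^sub>n\<close>; only odd \<open>n\<close> matter. The product of vectors is entrywise, so
  \<^const>\<open>prod_list\<close> is the Hadamard product of the factors.
\<close>

function series_term :: "real^'m^'m \<Rightarrow> nat \<Rightarrow> real^'m \<Rightarrow> real^'m" where
  "series_term P n \<eta> =
     (if n = 1 then \<eta>
      else if odd n then
        - (P *v (\<Sum>k = 1..(n - 1) div 2. arcsin_coeff k *\<^sub>R
            (\<Sum>\<alpha>s\<in>odd_tuples (2 * k + 1) n. prod_list (map (\<lambda>\<alpha>. series_term P \<alpha> \<eta>) \<alpha>s))))
      else 0)"
  by pat_completeness auto
termination
  by (relation "Wellfounded.measure (\<lambda>(P, n, \<eta>). n)") (auto intro: odd_tuples_less[simplified])

declare series_term.simps [simp del]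

lemma series_term_1: "series_term P 1 \<eta> = \<eta>"
  by (subst series_term.simps) simp

lemma series_term_rec:
  assumes "i \<ge> 1"
  shows "series_term P (2 * i + 1) \<eta> =
    - (P *v (\<Sum>k = 1..i. arcsin_coeff k *\<^sub>R
        (\<Sum>\<alpha>s\<in>odd_tuples (2 * k + 1) (2 * i + 1).
          prod_list (map (\<lambda>\<alpha>. series_term P \<alpha> \<eta>) \<alpha>s))))"
  using assms by (subst series_term.simps) simp

text \<open>A multi-index is a function \<^typ>\<open>'m \<Rightarrow> nat\<close>.\<close>

definition multi_degree :: "('m::finite \<Rightarrow> nat) \<Rightarrow> nat" where
  "multi_degree \<nu> = (\<Sum>e\<in>UNIV. \<nu> e)"

definition monomial :: "real^'m \<Rightarrow> ('m \<Rightarrow> nat) \<Rightarrow> real" where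
  "monomial x \<nu> = (\<Prod>e\<in>UNIV. (x $ e) ^ \<nu> e)"

definition homogeneous_polynomial ::
    "nat \<Rightarrow> (('m::finite \<Rightarrow> nat) \<Rightarrow> 'v::real_vector) \<Rightarrow> real^'m \<Rightarrow> 'v" where
  "homogeneous_polynomial d c x = (\<Sum>\<nu> | multi_degree \<nu> = d. monomial x \<nu> *\<^sub>R c \<nu>)"

lemma finite_multi_degree: "finite {\<nu> :: 'm::finite \<Rightarrow> nat. multi_degree \<nu> = d}"
proof (rule finite_subset)
  show "{\<nu> :: 'm \<Rightarrow> nat. multi_degree \<nu> = d} \<subseteq> Pi\<^sub>E UNIV (\<lambda>_. {..d})"
    by (auto simp: multi_degree_def intro: member_le_sum)
qed (simp add: finite_PiE)

text \<open>
  The rearrangements of a power series in \<open>m\<close> variables are its enumerations, i.e. the bijections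
  from \<^typ>\<open>nat\<close> to the multi-indices.
\<close>

definition strongly_sums ::
    "(('m::finite \<Rightarrow> nat) \<Rightarrow> 'v::real_normed_vector) \<Rightarrow> real^'m \<Rightarrow> real^'m \<Rightarrow> 'v \<Rightarrow> bool" where
  "strongly_sums c x0 x l \<longleftrightarrow>
     (\<forall>\<sigma> :: nat \<Rightarrow> 'm \<Rightarrow> nat. bij \<sigma> \<longrightarrow> (\<lambda>k. monomial (x - x0) (\<sigma> k) *\<^sub>R c (\<sigma> k)) sums l)"

end

theory Submission
  imports Defs "HOL-Complex_Analysis.Complex_Analysis"
begin

text \<open>
  Write \<open>P\<close> for the cycle projection, \<open>N\<close> for its norm and \<open>g z = arcsin z - z\<close>. As the two projections
  add up to the identity, the edge balance map is \<open>F \<phi> = \<phi> + P (g \<phi>)\<close> with \<open>g\<close> applied componentwise.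
  What follows holds for an arbitrary real matrix \<open>P\<close>.

  The power series of \<open>g\<close> has nonnegative coefficients. Hence on the polydisk of radius \<open>R < 1\<close> the map
  \<open>\<phi> \<mapsto> P (g \<phi>)\<close> is bounded by \<open>N * (arcsin R - R)\<close> and has the Lipschitz constant
  \<open>q = N * (1 / sqrt (1 - R\<^sup>2) - 1)\<close>, in the maximum norm. If \<open>q < 1\<close>, then \<open>F\<close> is injective on this
  polydisk, with invertible derivative, and it attains there every \<open>\<xi>\<close> of norm less than
  \<open>R - N * (arcsin R - R)\<close>. So \<open>F\<close> has an inverse on the open polydisk of that radius
  (\<open>inv_map\<close>), which is holomorphic by the inverse function theorem (\<open>has_derivative_inv_map\<close>).
  For \<open>R = sin \<gamma>\<close>, where \<open>\<gamma>\<close> belongs to \<open>r = h x\<close> with \<open>cos \<gamma> = x / (x + 1)\<close>, the condition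
  \<open>q < 1\<close> says \<open>N < x\<close>, and \<open>r < R - N * (arcsin R - R)\<close> holds because the difference of the two sides
  is \<open>(x - N) * (\<gamma> - sin \<gamma>)\<close>. As \<open>h\<close> is strictly decreasing, \<open>N < x\<close> is the hypothesis
  \<open>r < h N\<close> (\<open>gamma_star_properties\<close>).

  For the series, restrict the inverse to the complex line through \<open>\<eta>\<close>. The function
  \<open>t \<mapsto> F\<^sup>-\<^sup>1 (t * \<eta>)\<close> is holomorphic on a disk of radius greater than 1, so its Taylor series converges
  at \<open>t = 1\<close>. Comparing coefficients in \<open>\<Psi> + P (g \<Psi>) = t * \<eta>\<close> shows that the \<open>n\<close>-th Taylor coefficient
  satisfies the recursion that defines \<open>A\<^sub>n \<eta>\<close> (\<open>formal_solution_nth\<close>, \<open>series_term_sums_inv_map\<close>).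

  Strong convergence follows from a majorant. Replacing \<open>P\<close> by the matrix with the entries \<open>- \<bar>P\<^sub>i\<^sub>j\<bar>\<close>
  removes all signs from the recursion, so the coefficients of \<open>A\<^sub>n\<close> are bounded in modulus by those of
  the modified polynomials (\<open>series_term_hom_majorized\<close>). The modified matrix satisfies the same
  bound on the row sums, hence the modified series converges at \<open>(\<bar>\<eta>\<^sub>e\<bar>)\<close> by the first part, and this
  is absolute convergence of the original series over all multi-indices.
\<close>

(* The symbol $ is kept for the components of vectors. *)
no_notation fps_nth (infixl "$" 75)

section \<open>The power series of the arcsine\<close>

lemma int_interval_eq_image: "{0..int i - 1} = int ` {..<i}"
  by (auto simp: lessThan_atLeast0 image_int_atLeastLessThan)

lemma double_fact_even: "double_fact (2 * int i) = (\<Prod>k<i. 2 * int k + 2)"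
proof -
  have "double_fact (2 * int i) = (\<Prod>k<i. 2 * int i - 2 * int k)"
    by (simp add: double_fact_def int_interval_eq_image prod.reindex)
  also have "\<dots> = (\<Prod>k<i. 2 * int (i - Suc k) + 2)"
    by (intro prod.cong) auto
  also have "\<dots> = (\<Prod>k<i. 2 * int k + 2)"
    by (rule prod.nat_diff_reindex)
  finally show ?thesis .
qed

lemma double_fact_odd: "double_fact (2 * int i - 1) = (\<Prod>k<i. 2 * int k + 1)"
proof -
  have "\<lceil>real_of_int (2 * int i - 1) / 2\<rceil> = int i"
    by (rule ceiling_unique) auto
  then have "double_fact (2 * int i - 1) = (\<Prod>k<i. 2 * int i - 1 - 2 * int k)"
    by (simp add: double_fact_def int_interval_eq_image prod.reindex)
  also have "\<dots> = (\<Prod>k<i. 2 * int (i - Suc k) + 1)"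
    by (intro prod.cong) auto
  also have "\<dots> = (\<Prod>k<i. 2 * int k + 1)"
    by (rule prod.nat_diff_reindex)
  finally show ?thesis .
qed

text \<open>The series \<open>\<Sum>i. (2 * i + 1) * arcsin_coeff i * x ^ (2 * i)\<close> of the derivative is thereby the binomial
  series of \<open>(1 - x\<^sup>2) powr (-1/2)\<close>.\<close>

lemma arcsin_coeff_binomial:
  "(2 * real i + 1) * arcsin_coeff i = (-1) ^ i * ((-1/2) gchoose i)"
proof -
  define b :: "nat \<Rightarrow> real" where
    "b i = real_of_int (\<Prod>k<i. 2 * int k + 1) / real_of_int (\<Prod>k<i. 2 * int k + 2)" for i
  have "b i = (-1) ^ i * ((-1/2) gchoose i)"
  proof (induction i)
    case (Suc i)
    have "(-1/2) * ((-1/2) gchoose i) =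
        real i * ((-1/2) gchoose i) + real (Suc i) * ((-1/2 :: real) gchoose Suc i)"
      using gbinomial_mult_1[of "-1/2 :: real" i] by simp
    then have "((-1/2 :: real) gchoose Suc i) = - ((2 * i + 1) / (2 * i + 2)) * ((-1/2) gchoose i)"
      by (simp add: field_simps)
    moreover have "b (Suc i) = b i * ((2 * i + 1) / (2 * i + 2))"
      by (simp add: b_def add.commute)
    ultimately show ?case
      using Suc by simp
  qed (simp add: b_def)
  moreover have "2 * real i + 1 > 0"
    by simp
  then have "(2 * real i + 1) * arcsin_coeff i = b i"
    unfolding arcsin_coeff_def b_def double_fact_even double_fact_odd
    by (simp add: divide_simps del: of_int_prod)
  ultimately show ?thesis
    by simp
qed

lemma arcsin_coeff_0: "arcsin_coeff 0 = 1"
  using arcsin_coeff_binomial[of 0] by simp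

lemma arcsin_coeff_pos: "arcsin_coeff i > 0"
  unfolding arcsin_coeff_def double_fact_even double_fact_odd
  by (intro divide_pos_pos mult_pos_pos) (auto intro!: prod_pos)

lemma arcsin_deriv_series:
  assumes "\<bar>x\<bar> < 1"
  shows "(\<lambda>i. (2 * real i + 1) * arcsin_coeff i * x ^ (2 * i)) sums (1 / sqrt (1 - x\<^sup>2))"
proof -
  have x: "x\<^sup>2 < 1"
    using assms by (simp add: abs_square_less_1)
  then have "(\<lambda>i. ((-1/2) gchoose i) * (- x\<^sup>2) ^ i) sums (1 + - x\<^sup>2) powr (-1/2)"
    by (intro gen_binomial_real) auto
  moreover have "((-1/2) gchoose i) * (- x\<^sup>2) ^ i = (2 * real i + 1) * arcsin_coeff i * x ^ (2 * i)" for i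
    unfolding arcsin_coeff_binomial by (simp add: power_mult power_minus[of "x\<^sup>2"])
  moreover have "(1 + - x\<^sup>2) powr (-1/2) = 1 / sqrt (1 - x\<^sup>2)"
    using x by (simp add: powr_minus_divide powr_half_sqrt)
  ultimately show ?thesis
    by simp
qed

text \<open>
  The power series of \<open>arcsin z - z\<close>, over the reals and over the complex numbers: the coefficient of
  \<open>z\<close> itself is dropped, and \<open>n div 2\<close> is the index \<open>i\<close> of the exponent \<open>n = 2 * i + 1\<close>.
\<close>

definition arcsin_tail_fps :: "'a::{banach, real_normed_field} fps" where
  "arcsin_tail_fps = Abs_fps (\<lambda>n. if odd n \<and> n \<noteq> 1 then of_real (arcsin_coeff (n div 2)) else 0)"

lemma arcsin_tail_fps_nth_nonneg: "fps_nth (arcsin_tail_fps :: real fps) n \<ge> 0"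
  using arcsin_coeff_pos[of "n div 2"] by (simp add: arcsin_tail_fps_def less_imp_le)

lemma norm_arcsin_tail_fps_nth:
  "norm (fps_nth (arcsin_tail_fps :: 'a::{banach, real_normed_field} fps) n) =
   fps_nth (arcsin_tail_fps :: real fps) n"
  using arcsin_coeff_pos[of "n div 2"] by (simp add: arcsin_tail_fps_def less_imp_le)

text \<open>The derivative series at a nonnegative real argument bounds the derivative on a complex disk.\<close>

lemma arcsin_tail_deriv_sums:
  assumes "\<bar>x\<bar> < 1"
  shows "(\<lambda>n. fps_nth (fps_deriv arcsin_tail_fps) n * x ^ n) sums (1 / sqrt (1 - x\<^sup>2) - 1)"
proof -
  define f where "f n = fps_nth (fps_deriv arcsin_tail_fps) n * x ^ n" for n
  have 0: "n = 0 \<or> n \<notin> range (\<lambda>i::nat. 2 * i) \<Longrightarrow> f n = 0" for n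
    unfolding f_def by (auto simp: arcsin_tail_fps_def image_iff elim!: evenE)
  have "(\<lambda>i. (2 * real i + 1) * arcsin_coeff i * x ^ (2 * i) -
      (if i = 0 then 1 else 0)) sums (1 / sqrt (1 - x\<^sup>2) - 1)"
    using arcsin_deriv_series[OF assms] sums_single[of 0 "\<lambda>_. 1 :: real"]
    by (intro sums_diff) auto
  also have "(\<lambda>i. (2 * real i + 1) * arcsin_coeff i * x ^ (2 * i) -
      (if i = 0 then 1 else 0)) = (\<lambda>i. f (2 * i))"
    by (auto simp: fun_eq_iff f_def arcsin_tail_fps_def arcsin_coeff_0)
  finally have "(\<lambda>i. f (2 * i)) sums (1 / sqrt (1 - x\<^sup>2) - 1)" .
  then have "f sums (1 / sqrt (1 - x\<^sup>2) - 1)"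
    using 0 by (subst (asm) sums_mono_reindex) (auto simp: strict_mono_def)
  then show ?thesis
    unfolding f_def .
qed

lemma arcsin_tail_conv_radius:
  "fps_conv_radius (arcsin_tail_fps :: 'a::{banach, real_normed_field} fps) \<ge> 1"
proof -
  have "conv_radius (fps_nth (arcsin_tail_fps :: 'a fps)) \<ge> ereal 1"
  proof (rule conv_radius_geI_ex')
    fix r :: real
    assume r: "0 < r" "ereal r < ereal 1"
    let ?b = "\<lambda>n. fps_nth (fps_deriv arcsin_tail_fps) n * r ^ n"
    have "summable (\<lambda>n. ?b n)"
      using arcsin_tail_deriv_sums[of r] r by (auto simp: sums_iff)
    moreover have "norm (fps_nth (arcsin_tail_fps :: 'a fps) (Suc n) * of_real r ^ Suc n) \<le> ?b n" for n
    proof -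
      have "norm (fps_nth (arcsin_tail_fps :: 'a fps) (Suc n) * of_real r ^ Suc n) =
          (r * fps_nth arcsin_tail_fps (Suc n)) * r ^ n"
        using r by (simp add: norm_mult norm_power norm_arcsin_tail_fps_nth)
      also have "\<dots> \<le> (real (Suc n) * fps_nth arcsin_tail_fps (Suc n)) * r ^ n"
        using r arcsin_tail_fps_nth_nonneg[of "Suc n"] by (intro mult_right_mono) auto
      finally show ?thesis
        by simp
    qed
    ultimately have "summable (\<lambda>n. fps_nth (arcsin_tail_fps :: 'a fps) (Suc n) * of_real r ^ Suc n)"
      by (rule summable_comparison_test'[where N = 0])
    then show "summable (\<lambda>n. fps_nth (arcsin_tail_fps :: 'a fps) n * of_real r ^ n)"
      by (rule iffD1[OF summable_Suc_iff])
  qed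
  then show ?thesis
    by (simp add: fps_conv_radius_def one_ereal_def)
qed

text \<open>The sum of this series; it is \<open>arcsin z - z\<close> on the open unit disk.\<close>

abbreviation arcsin_tail :: "'a::{banach, real_normed_field} \<Rightarrow> 'a" where
  "arcsin_tail \<equiv> eval_fps arcsin_tail_fps"

lemma less_arcsin_tail_conv_radius:
  "norm (z :: 'a::{banach, real_normed_field}) < 1 \<Longrightarrow>
    ereal (norm z) < fps_conv_radius (arcsin_tail_fps :: 'a fps)"
  using arcsin_tail_conv_radius[where 'a = 'a]
  by (metis ereal_less(3) less_le_trans)

lemma arcsin_series_eq:
  assumes "norm z < 1"
  shows "arcsin_series z = z + arcsin_tail z"
proof -
  define f where "f n = fps_nth arcsin_tail_fps n * z ^ n + (if n = 1 then z ^ n else 0)" for n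
  have "(\<lambda>n. fps_nth arcsin_tail_fps n * z ^ n + (if n = 1 then z ^ n else 0)) sums (arcsin_tail z + z ^ 1)"
    using less_arcsin_tail_conv_radius[OF assms] by (intro sums_add sums_eval_fps sums_single)
  then have "f sums (z + arcsin_tail z)"
    unfolding f_def by (simp add: add.commute)
  moreover have "strict_mono (\<lambda>i::nat. 2 * i + 1)"
    by (simp add: strict_mono_def)
  moreover have "f n = 0" if "n \<notin> range (\<lambda>i. 2 * i + 1)" for n
    using that by (auto simp: f_def arcsin_tail_fps_def elim!: oddE)
  ultimately have "(\<lambda>i. f (2 * i + 1)) sums (z + arcsin_tail z)"
    by (subst sums_mono_reindex) auto
  moreover have "f (2 * i + 1) = complex_of_real (arcsin_coeff i) * z ^ (2 * i + 1)" for i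
    by (auto simp: f_def arcsin_tail_fps_def arcsin_coeff_0)
  ultimately show ?thesis
    by (simp add: arcsin_series_def sums_iff)
qed

lemma arcsin_tail_real:
  assumes "\<bar>x\<bar> < 1"
  shows "arcsin_tail x = arcsin x - x"
proof -
  have "((\<lambda>x. arcsin x - x - arcsin_tail x) has_field_derivative 0) (at t)"
    if "t \<in> {-1<..<1}" for t
  proof -
    have t: "norm t < 1"
      using that by auto
    moreover have "eval_fps (fps_deriv arcsin_tail_fps) t = 1 / sqrt (1 - t\<^sup>2) - 1"
      using arcsin_tail_deriv_sums[of t] t unfolding eval_fps_def sums_iff by simp
    ultimately show ?thesis
      using that less_arcsin_tail_conv_radius[of t]
      by (auto intro!: derivative_eq_intros has_field_derivative_eval_fps simp: divide_simps)
  qed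
  then have "arcsin x - x - arcsin_tail x = arcsin 0 - 0 - arcsin_tail 0"
    using assms by (intro DERIV_isconst3[of "-1" 1]) auto
  then show ?thesis
    by (simp add: eval_fps_at_0 arcsin_tail_fps_def)
qed

lemma norm_arcsin_tail_le:
  fixes z :: "'a::{banach, real_normed_field}"
  assumes "norm z \<le> R" "R < 1"
  shows "norm (arcsin_tail z) \<le> arcsin R - R"
proof -
  have R: "0 \<le> R"
    using assms norm_ge_zero order_trans by blast
  have 1: "(\<lambda>n. fps_nth arcsin_tail_fps n * R ^ n) sums (arcsin R - R)"
    using sums_eval_fps[OF less_arcsin_tail_conv_radius[of R]] arcsin_tail_real[of R] assms R by simp
  have "norm (fps_nth (arcsin_tail_fps :: 'a fps) n * z ^ n) \<le> fps_nth arcsin_tail_fps n * R ^ n"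
    (is "norm (?f n) \<le> ?g n") for n
    using assms arcsin_tail_fps_nth_nonneg
    by (auto simp: norm_mult norm_power norm_arcsin_tail_fps_nth intro!: mult_left_mono power_mono)
  then have "norm (suminf ?f) \<le> (\<Sum>n. ?g n)"
    by (rule norm_suminf_le) (rule sums_summable[OF 1])
  then show ?thesis
    using 1 by (simp add: eval_fps_def sums_iff del: fps_deriv_nth)
qed

lemma arcsin_tail_has_derivative:
  assumes "norm (z :: complex) < 1"
  shows "(arcsin_tail has_field_derivative eval_fps (fps_deriv arcsin_tail_fps) z) (at z)"
  using less_arcsin_tail_conv_radius[OF assms] by (intro has_field_derivative_eval_fps)

lemma norm_deriv_arcsin_tail_le:
  fixes z :: "'a::{banach, real_normed_field}"
  assumes "norm z \<le> R" "R < 1"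
  shows "norm (eval_fps (fps_deriv arcsin_tail_fps) z) \<le> 1 / sqrt (1 - R\<^sup>2) - 1"
proof -
  have R: "0 \<le> R"
    using assms norm_ge_zero order_trans by blast
  have 1: "(\<lambda>n. fps_nth (fps_deriv arcsin_tail_fps) n * R ^ n) sums (1 / sqrt (1 - R\<^sup>2) - 1)"
    using arcsin_tail_deriv_sums[of R] assms R by simp
  have "norm (fps_nth (fps_deriv (arcsin_tail_fps :: 'a fps)) n * z ^ n) \<le>
      fps_nth (fps_deriv arcsin_tail_fps) n * R ^ n" (is "norm (?f n) \<le> ?g n") for n
    using assms arcsin_tail_fps_nth_nonneg[of "Suc n"]
    by (auto simp: norm_mult norm_power norm_arcsin_tail_fps_nth norm_of_nat
        simp del: of_nat_Suc intro!: mult_mono power_mono)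
  then have "norm (suminf ?f) \<le> (\<Sum>n. ?g n)"
    by (rule norm_suminf_le) (rule sums_summable[OF 1])
  then show ?thesis
    using 1 by (simp add: eval_fps_def sums_iff del: fps_deriv_nth)
qed

lemma arcsin_tail_lipschitz:
  fixes z w :: complex
  assumes "norm z \<le> R" "norm w \<le> R" "R < 1"
  shows "norm (arcsin_tail z - arcsin_tail w) \<le> (1 / sqrt (1 - R\<^sup>2) - 1) * norm (z - w)"
  by (rule field_differentiable_bound[of "cball 0 R"])
    (use assms in \<open>auto intro!: norm_deriv_arcsin_tail_le
      has_field_derivative_at_within[OF arcsin_tail_has_derivative]\<close>)

section \<open>The function h\<close>

lemma frac_in_unit_interval:
  fixes x :: real
  assumes "x \<ge> 0"
  shows "0 \<le> x / (x + 1)" "x / (x + 1) < 1"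
  using assms by (auto simp: field_simps)

text \<open>The angle at which \<open>\<lambda>t. (x + 1) * sin t - x * t\<close> is maximal on \<open>{0..pi / 2}\<close>.\<close>

definition h_angle :: "real \<Rightarrow> real" where
  "h_angle x = arccos (x / (x + 1))"

lemma cos_h_angle: "x \<ge> 0 \<Longrightarrow> cos (h_angle x) = x / (x + 1)"
  using frac_in_unit_interval[of x] unfolding h_angle_def by (intro cos_arccos) linarith+

lemma h_angle_bounds:
  assumes "x \<ge> 0"
  shows "0 < h_angle x" "h_angle x \<le> pi / 2"
proof -
  note f = frac_in_unit_interval[OF assms]
  have "arccos 1 < arccos (x / (x + 1))"
    using f by (intro arccos_less_arccos) auto
  then show "0 < h_angle x"
    by (simp add: h_angle_def)
  show "h_angle x \<le> pi / 2"
    using arccos_le_pi2[OF f(1)] f(2) by (simp add: h_angle_def)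
qed

lemma h_eq:
  assumes "x \<ge> 0"
  shows "h x = (x + 1) * sin (h_angle x) - x * h_angle x"
  using frac_in_unit_interval[OF assms] by (simp add: h_def h_angle_def sin_arccos)

lemma sin_le_tangent:
  assumes "0 \<le> s" "s \<le> pi" "0 \<le> t" "t \<le> pi"
  shows "sin t \<le> sin s + cos s * (t - s)"
proof -
  have "sin s - sin t + (cos s) * (t - s) \<ge> 0"
  proof (cases "s = t")
    case False
    have d: "(sin has_field_derivative cos x) (at x)" for x :: real
      by (rule DERIV_sin)
    show ?thesis
    proof (cases "s < t")
      case True
      then obtain z where z: "s < z" "z < t" "sin t - sin s = (t - s) * cos z"
        using MVT2[OF True d] by auto
      then have "cos z \<le> cos s"
        using assms by (intro cos_monotone_0_pi_le) auto
      then have "(t - s) * cos z \<le> (t - s) * cos s"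
        using True by (intro mult_left_mono) auto
      then have "sin t - sin s \<le> (t - s) * cos s"
        using z(3) by simp
      then show ?thesis
        by (simp add: mult.commute)
    next
      case F: False
      then have ts: "t < s"
        using False by simp
      then obtain z where z: "t < z" "z < s" "sin s - sin t = (s - t) * cos z"
        using MVT2[OF ts d] by auto
      then have "cos s \<le> cos z"
        using assms by (intro cos_monotone_0_pi_le) auto
      then have "(s - t) * cos s \<le> (s - t) * cos z"
        using ts by (intro mult_left_mono) auto
      then have "(s - t) * cos s \<le> sin s - sin t"
        using z(3) by simp
      then show ?thesis
        by (simp add: algebra_simps)
    qed
  qed simp
  then show ?thesis
    by simp
qed

text \<open>The sine lies below its tangent at the angle \<open>s\<close> with \<open>(x + 1) * cos s = x\<close>.\<close>

lemma h_maximal: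
  assumes "x \<ge> 0" "0 \<le> t" "t \<le> pi / 2"
  shows "(x + 1) * sin t - x * t \<le> h x"
proof -
  define s where "s = h_angle x"
  have "sin t \<le> sin s + cos s * (t - s)"
    using assms h_angle_bounds[of x] pi_gt_zero unfolding s_def by (intro sin_le_tangent) auto
  then have "(x + 1) * sin t \<le> (x + 1) * (sin s + cos s * (t - s))"
    using assms by (intro mult_left_mono) auto
  also have "\<dots> = (x + 1) * sin s + ((x + 1) * cos s) * (t - s)"
    by (simp add: algebra_simps)
  also have "(x + 1) * cos s = x"
    using assms by (simp add: s_def cos_h_angle)
  finally show ?thesis
    using assms by (simp add: h_eq s_def[symmetric] algebra_simps)
qed

lemma sin_less_self:
  assumes "0 < t"
  shows "sin t < (t :: real)"
proof (cases "t \<le> 1")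
  case True
  obtain z where z: "0 < z" "z < t" "sin t - sin 0 = (t - 0) * cos z"
    using MVT2[OF assms DERIV_sin] by auto
  have "cos z < cos 0"
    using z True pi_gt3 by (intro cos_monotone_0_pi) auto
  then have "t * cos z < t * 1"
    using assms by (intro mult_strict_left_mono) auto
  then show ?thesis
    using z by simp
next
  case False
  then show ?thesis
    using sin_le_one[of t] by linarith
qed

text \<open>The function that \<open>h x\<close> maximizes, at the maximal angle of another parameter \<open>y\<close>.\<close>

lemma h_gap:
  assumes "0 \<le> x" "0 \<le> y"
  shows "(x + 1) * sin (h_angle y) - x * h_angle y = h y + (y - x) * (h_angle y - sin (h_angle y))"
  using assms by (simp add: h_eq algebra_simps)

lemma h_strict_antimono:
  assumes "0 \<le> x" "x < y"
  shows "h y < h x"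
proof -
  have "h_angle y - sin (h_angle y) > 0"
    using h_angle_bounds[of y] sin_less_self assms by simp
  then have "h y < (x + 1) * sin (h_angle y) - x * h_angle y"
    using assms by (subst h_gap) auto
  also have "\<dots> \<le> h x"
    using assms h_angle_bounds[of y] by (intro h_maximal) auto
  finally show ?thesis .
qed

lemma inj_on_h: "inj_on h {0..}"
  by (rule linorder_inj_onI) (use h_strict_antimono in fastforce)+

text \<open>Since the angle tends to 0 as \<open>x\<close> grows, \<open>h\<close> takes arbitrarily small values.\<close>

lemma h_le_angle:
  assumes "x \<ge> 0"
  shows "h x \<le> h_angle x"
proof -
  have "(x + 1) * sin (h_angle x) \<le> (x + 1) * h_angle x"
    using assms h_angle_bounds[of x] sin_x_le_x[of "h_angle x"] by (intro mult_left_mono) auto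
  then show ?thesis
    using assms by (simp add: h_eq algebra_simps)
qed

lemma continuous_on_h: "continuous_on {0..} h"
proof -
  have "- 1 \<le> x / (x + 1) \<and> x / (x + 1) \<le> 1" if "x \<ge> 0" for x :: real
    using frac_in_unit_interval[OF that] by linarith
  then show ?thesis
    unfolding h_def by (intro continuous_intros) auto
qed

text \<open>The value \<open>r\<close> is attained between \<open>N\<close> and a point \<open>y\<close> whose angle is at most \<open>min r 1\<close>.\<close>

lemma h_surj:
  assumes "N \<ge> 0" "0 < r" "r < h N"
  obtains x where "x > N" "h x = r"
proof -
  define t where "t = min r 1"
  \<comment> \<open>\<open>c = y / (y + 1)\<close> is solved by \<open>y = c / (1 - c)\<close>.\<close>
  define y where "y = max N (cos t / (1 - cos t))"
  have t: "0 < t" "t \<le> 1" "t \<le> r"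
    using assms by (auto simp: t_def)
  have "t < pi"
    using t pi_gt3 by simp
  have "cos t < 1"
    using cos_monotone_0_pi[of 0 t] t \<open>t < pi\<close> by simp
  have "0 \<le> cos t"
    using t pi_gt3 by (intro cos_ge_zero) auto
  have y: "y \<ge> 0" "N \<le> y"
    using assms by (auto simp: y_def)
  have "cos t / (1 - cos t) \<le> y"
    by (simp add: y_def)
  then have "cos t \<le> y / (y + 1)"
    using \<open>cos t < 1\<close> y by (simp add: field_simps)
  then have "arccos (y / (y + 1)) \<le> arccos (cos t)"
    using frac_in_unit_interval[OF y(1)] by (intro arccos_le_arccos) (auto intro: order_trans[OF _ \<open>0 \<le> cos t\<close>])
  then have "h_angle y \<le> t"
    using t \<open>t < pi\<close> by (simp add: h_angle_def arccos_cos)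
  then have "h y \<le> r"
    using h_le_angle[OF y(1)] t by simp
  then obtain x where "N \<le> x" "x \<le> y" "h x = r"
    using IVT2'[of h y r N] assms y continuous_on_subset[OF continuous_on_h, of "{N..y}"] by auto
  then have "x \<noteq> N"
    using assms by auto
  then show ?thesis
    using that[of x] \<open>N \<le> x\<close> \<open>h x = r\<close> by simp
qed

text \<open>The last two statements are the contraction and the self-map condition for the radius \<open>sin \<gamma>\<close>. The
  second one is strict because \<open>x > N\<close> for the parameter \<open>x\<close> with \<open>h x = r\<close>.\<close>

lemma gamma_star_properties:
  assumes "N \<ge> 0" "0 < r" "r < h N"
  defines "\<gamma> \<equiv> gamma_star r"
  shows "0 < \<gamma>" "\<gamma> < pi / 2" "N * (1 / cos \<gamma> - 1) < 1" "r < sin \<gamma> - N * (\<gamma> - sin \<gamma>)"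
proof -
  obtain x where x: "x > N" "h x = r"
    using h_surj[OF assms(1-3)] by blast
  have x0: "x > 0"
    using x assms by simp
  have "h_inv r = x"
    using x assms the_inv_into_f_f[OF inj_on_h, of x] by (simp add: h_inv_def)
  then have \<gamma>: "\<gamma> = h_angle x"
    using assms by (simp add: gamma_star_def h_angle_def)
  show "0 < \<gamma>"
    using h_angle_bounds[of x] x0 \<gamma> by simp
  have c: "cos \<gamma> = x / (x + 1)"
    using cos_h_angle[of x] x0 \<gamma> by simp
  then have "cos \<gamma> > 0"
    using x0 by simp
  then have "\<gamma> \<noteq> pi / 2"
    using cos_pi_half by force
  then show "\<gamma> < pi / 2"
    using h_angle_bounds[of x] x0 \<gamma> by simp
  show "N * (1 / cos \<gamma> - 1) < 1"
    using x x0 by (simp add: c field_simps)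
  have "0 < (x - N) * (\<gamma> - sin \<gamma>)"
    using x sin_less_self[OF \<open>0 < \<gamma>\<close>] by simp
  then show "r < sin \<gamma> - N * (\<gamma> - sin \<gamma>)"
    using h_gap[of N x] assms x x0 \<gamma> by (simp add: algebra_simps)
qed

section \<open>The maximum norm\<close>

lemma vec_norm_inf_le_iff: "vec_norm_inf x \<le> r \<longleftrightarrow> (\<forall>i. norm (x $ i) \<le> r)"
  by (simp add: vec_norm_inf_def)

lemma vec_norm_inf_less_iff: "vec_norm_inf x < r \<longleftrightarrow> (\<forall>i. norm (x $ i) < r)"
  by (simp add: vec_norm_inf_def)

lemma norm_nth_le_vec_norm_inf: "norm (x $ i) \<le> vec_norm_inf x"
  using vec_norm_inf_le_iff[of x "vec_norm_inf x"] by simp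

lemma vec_norm_inf_nonneg: "0 \<le> vec_norm_inf x"
  by (rule order_trans[OF norm_ge_zero norm_nth_le_vec_norm_inf])

lemma vec_norm_inf_eq_0_iff: "vec_norm_inf x = 0 \<longleftrightarrow> x = 0"
proof -
  have "vec_norm_inf x = 0 \<longleftrightarrow> vec_norm_inf x \<le> 0"
    using vec_norm_inf_nonneg[of x] by auto
  then show ?thesis
    by (simp add: vec_norm_inf_le_iff vec_eq_iff)
qed

lemma vec_norm_inf_cong: "(\<And>i. norm (x $ i) = norm (y $ i)) \<Longrightarrow> vec_norm_inf x = vec_norm_inf y"
  by (simp add: vec_norm_inf_def)

lemma vec_norm_inf_cvec: "vec_norm_inf (cvec x) = vec_norm_inf x"
  by (rule vec_norm_inf_cong) (simp add: cvec_def)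

lemma vec_norm_inf_add_le: "vec_norm_inf (x + y) \<le> vec_norm_inf x + vec_norm_inf y"
  unfolding vec_norm_inf_le_iff
  by (auto intro!: norm_triangle_le add_mono norm_nth_le_vec_norm_inf)

lemma vec_norm_inf_minus: "vec_norm_inf (- x) = vec_norm_inf x"
  by (rule vec_norm_inf_cong) simp

lemma vec_norm_inf_scale_le: "vec_norm_inf (t *s x) \<le> norm t * vec_norm_inf x" for x :: "complex^'m"
  unfolding vec_norm_inf_le_iff
  by (auto simp: norm_mult intro!: mult_left_mono norm_nth_le_vec_norm_inf)

lemma vec_norm_inf_le_norm: "vec_norm_inf x \<le> norm x"
  unfolding vec_norm_inf_le_iff by (simp add: Finite_Cartesian_Product.norm_nth_le)

lemma norm_le_vec_norm_inf:
  fixes x :: "'a::real_normed_vector^'m"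
  shows "norm x \<le> CARD('m) * vec_norm_inf x"
proof -
  have "norm x \<le> (\<Sum>i\<in>UNIV. norm (x $ i))"
    by (simp add: norm_vec_def L2_set_le_sum)
  also have "\<dots> \<le> (\<Sum>i\<in>(UNIV :: 'm set). vec_norm_inf x)"
    by (intro sum_mono norm_nth_le_vec_norm_inf)
  finally show ?thesis
    by simp
qed

lemma mem_polydisk_0: "w \<in> polydisk 0 r \<longleftrightarrow> vec_norm_inf w \<le> r"
  using vec_norm_inf_minus[of w] by (simp add: polydisk_def)

lemma polydisk_0_eq: "polydisk 0 r = (\<Inter>i. {w. w $ i \<in> cball 0 r})"
  by (auto simp: mem_polydisk_0 vec_norm_inf_le_iff)

lemma compact_polydisk: "compact (polydisk 0 r :: (complex^'m) set)"
proof -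
  have "closed {w :: complex^'m. w $ i \<in> cball 0 r}" for i
    using continuous_closed_vimage[of "cball 0 r" "\<lambda>w :: complex^'m. w $ i"]
    by (auto simp: vimage_def intro!: continuous_intros)
  then have "closed (polydisk 0 r :: (complex^'m) set)"
    unfolding polydisk_0_eq by auto
  moreover have "norm w \<le> CARD('m) * r" if "w \<in> polydisk 0 r" for w :: "complex^'m"
    by (rule order_trans[OF norm_le_vec_norm_inf])
      (use that in \<open>auto simp: mem_polydisk_0 intro!: mult_left_mono\<close>)
  then have "bounded (polydisk 0 r :: (complex^'m) set)"
    by (auto simp: bounded_iff)
  ultimately show ?thesis
    by (simp add: compact_eq_bounded_closed)
qed

lemma convex_polydisk: "convex (polydisk 0 r :: (complex^'m) set)"
proof -
  have "convex {w :: complex^'m. w $ i \<in> cball 0 r}" for i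
    using convex_cball[of "0 :: complex" r] unfolding convex_def by (simp only: mem_Collect_eq vector_add_component vector_scaleR_component) blast
  then show ?thesis
    unfolding polydisk_0_eq by (intro convex_INT) auto
qed

lemma vec_norm_inf_cmat_mult_le:
  fixes P :: "real^'n^'m" and v :: "complex^'n"
  assumes "\<And>i. (\<Sum>j\<in>UNIV. \<bar>P $ i $ j\<bar>) \<le> N"
  shows "vec_norm_inf (cmat P *v v) \<le> N * vec_norm_inf v"
  unfolding vec_norm_inf_le_iff
proof
  fix i
  have "norm ((cmat P *v v) $ i) \<le> (\<Sum>j\<in>UNIV. norm (complex_of_real (P $ i $ j) * v $ j))"
    by (simp add: cmat_def matrix_vector_mult_def norm_sum)
  also have "\<dots> \<le> (\<Sum>j\<in>UNIV. \<bar>P $ i $ j\<bar> * vec_norm_inf v)"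
    by (intro sum_mono) (auto simp: norm_mult intro!: mult_left_mono norm_nth_le_vec_norm_inf)
  also have "\<dots> \<le> N * vec_norm_inf v"
    unfolding sum_distrib_right[symmetric]
    by (intro mult_right_mono assms vec_norm_inf_nonneg)
  finally show "norm ((cmat P *v v) $ i) \<le> N * vec_norm_inf v" .
qed

text \<open>The norm induced by the maximum norm bounds each absolute row sum, because the row sum is
  attained at the vector of signs of the row.\<close>

lemma row_sum_le_mat_norm_inf:
  fixes P :: "real^'n^'m"
  shows "(\<Sum>j\<in>UNIV. \<bar>P $ i $ j\<bar>) \<le> mat_norm_inf P"
proof -
  define s :: "real^'n" where "s = (\<chi> j. if P $ i $ j \<ge> 0 then 1 else -1)"
  have "vec_norm_inf s = vec_norm_inf (1 :: real^'n)"
    by (rule vec_norm_inf_cong) (simp add: s_def)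
  also have "\<dots> = 1"
    by (simp add: vec_norm_inf_def)
  finally have s: "vec_norm_inf s = 1" .
  have "(\<Sum>j\<in>UNIV. \<bar>P $ i $ j\<bar>) = (P *v s) $ i"
    by (auto simp: matrix_vector_mult_def s_def intro!: sum.cong)
  also have "\<dots> \<le> norm ((P *v s) $ i)"
    by simp
  also have "\<dots> \<le> vec_norm_inf (P *v s)"
    by (rule norm_nth_le_vec_norm_inf)
  also have "\<dots> \<le> mat_norm_inf P"
    unfolding mat_norm_inf_def
  proof (rule cSUP_upper)
    have "vec_norm_inf (P *v x) \<le> onorm ((*v) P) * CARD('n)" if "vec_norm_inf x = 1" for x
    proof -
      have "norm (P *v x) \<le> onorm ((*v) P) * norm x"
        by (rule onorm) simp
      also have "\<dots> \<le> onorm ((*v) P) * CARD('n)"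
        using norm_le_vec_norm_inf[of x] that by (intro mult_left_mono onorm_pos_le) auto
      finally show ?thesis
        using vec_norm_inf_le_norm order_trans by blast
    qed
    then show "bdd_above ((\<lambda>x. vec_norm_inf (P *v x)) ` {x. vec_norm_inf x = 1})"
      by (auto simp: bdd_above_def)
  qed (use s in simp)
  finally show ?thesis .
qed

lemma has_derivative_vec_lambda:
  fixes f :: "'a::real_normed_vector \<Rightarrow> 'i::finite \<Rightarrow> 'b::euclidean_space"
  assumes "\<And>i. ((\<lambda>x. f x i) has_derivative (\<lambda>v. f' v i)) (at a)"
  shows "((\<lambda>x. \<chi> i. f x i) has_derivative (\<lambda>v. \<chi> i. f' v i)) (at a)"
  unfolding has_derivative_componentwise_within[of "\<lambda>x. \<chi> i. f x i"]
  by (auto simp: Basis_vec_def inner_axis intro!: has_derivative_inner_left assms)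

section \<open>The edge balance map on a small polydisk\<close>

text \<open>
  If \<open>N\<close> bounds the row sums of \<open>P\<close>, then \<open>N * (1 / sqrt (1 - R\<^sup>2) - 1)\<close> is a
  Lipschitz constant of \<open>\<lambda>\<phi>. P (arcsin \<phi> - \<phi>)\<close> on the polydisk of radius \<open>R\<close> in the maximum norm.
\<close>

locale edge_balance_contraction =
  fixes P :: "real^'m^'m" and N R :: real
  assumes row_sum: "(\<Sum>j\<in>UNIV. \<bar>P $ i $ j\<bar>) \<le> N"
    and R_pos: "0 < R" and R_less_1: "R < 1"
    and contraction: "N * (1 / sqrt (1 - R\<^sup>2) - 1) < 1"
begin

text \<open>A Lipschitz constant of the map \<open>tail\<close> defined next.\<close>

definition q :: real where
  "q = N * (1 / sqrt (1 - R\<^sup>2) - 1)"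

text \<open>The deviation of the edge balance map from the identity.\<close>

definition tail :: "complex^'m \<Rightarrow> complex^'m" where
  "tail \<phi> = cmat P *v (\<chi> e. arcsin_tail (\<phi> $ e))"

text \<open>The right-hand sides \<open>\<xi>\<close> of norm less than \<open>radius\<close> have a preimage of norm less than \<open>R\<close>.\<close>

definition radius :: real where
  "radius = R - N * (arcsin R - R)"

lemma tail_nth: "tail \<phi> $ i = (\<Sum>j\<in>UNIV. of_real (P $ i $ j) * arcsin_tail (\<phi> $ j))"
  by (simp add: tail_def cmat_def matrix_vector_mult_def)

lemma tail_0: "tail 0 = 0"
  by (simp add: vec_eq_iff tail_nth eval_fps_at_0 arcsin_tail_fps_def)

lemma N_nonneg: "0 \<le> N"
  by (rule order_trans[OF _ row_sum[of undefined]]) (simp add: sum_nonneg)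

lemma q_bounds: "0 \<le> q" "q < 1"
proof -
  have "R\<^sup>2 < 1"
    using R_pos R_less_1 by (simp add: power_less_one_iff)
  then have "1 / sqrt (1 - R\<^sup>2) \<ge> 1"
    by (simp add: real_sqrt_le_1_iff)
  then show "0 \<le> q"
    unfolding q_def using N_nonneg by (intro mult_nonneg_nonneg) auto
  show "q < 1"
    using contraction by (simp add: q_def)
qed

lemma tail_lipschitz:
  assumes "vec_norm_inf \<phi> \<le> R" "vec_norm_inf \<psi> \<le> R"
  shows "vec_norm_inf (tail \<phi> - tail \<psi>) \<le> q * vec_norm_inf (\<phi> - \<psi>)"
proof -
  define w where "w = (\<chi> e. arcsin_tail (\<phi> $ e)) - (\<chi> e. arcsin_tail (\<psi> $ e))"
  define L where "L = 1 / sqrt (1 - R\<^sup>2) - 1"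
  have "0 \<le> L"
    using norm_deriv_arcsin_tail_le[of "0 :: real" R] R_pos R_less_1 norm_ge_zero order_trans
    unfolding L_def by fastforce
  have "norm (w $ e) \<le> L * vec_norm_inf (\<phi> - \<psi>)" for e
  proof -
    have "norm (w $ e) \<le> L * norm (\<phi> $ e - \<psi> $ e)"
      using assms R_less_1 unfolding w_def L_def vec_norm_inf_le_iff
      by (simp add: arcsin_tail_lipschitz)
    also have "\<dots> \<le> L * vec_norm_inf (\<phi> - \<psi>)"
      using norm_nth_le_vec_norm_inf[of "\<phi> - \<psi>" e] \<open>0 \<le> L\<close> by (intro mult_left_mono) auto
    finally show ?thesis .
  qed
  then have "vec_norm_inf w \<le> L * vec_norm_inf (\<phi> - \<psi>)"
    by (simp add: vec_norm_inf_le_iff)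
  then have "N * vec_norm_inf w \<le> N * (L * vec_norm_inf (\<phi> - \<psi>))"
    using N_nonneg by (rule mult_left_mono)
  moreover have "vec_norm_inf (cmat P *v w) \<le> N * vec_norm_inf w"
    by (intro vec_norm_inf_cmat_mult_le row_sum)
  moreover have "tail \<phi> - tail \<psi> = cmat P *v w"
    by (simp add: tail_def w_def matrix_vector_mult_diff_distrib)
  ultimately show ?thesis
    by (simp add: q_def L_def mult.assoc)
qed

lemma vec_norm_inf_tail_le:
  assumes "vec_norm_inf \<phi> \<le> R"
  shows "vec_norm_inf (tail \<phi>) \<le> N * (arcsin R - R)"
proof -
  have "vec_norm_inf (tail \<phi>) \<le> N * vec_norm_inf (\<chi> e. arcsin_tail (\<phi> $ e))"
    unfolding tail_def by (intro vec_norm_inf_cmat_mult_le row_sum)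
  also have "\<dots> \<le> N * (arcsin R - R)"
    using assms R_less_1 N_nonneg
    by (intro mult_left_mono) (auto simp: vec_norm_inf_le_iff norm_arcsin_tail_le)
  finally show ?thesis .
qed

lemma inverse_lipschitz:
  assumes "vec_norm_inf \<phi> \<le> R" "vec_norm_inf \<psi> \<le> R"
  shows "(1 - q) * vec_norm_inf (\<phi> - \<psi>) \<le> vec_norm_inf ((\<phi> + tail \<phi>) - (\<psi> + tail \<psi>))"
proof -
  have "\<phi> - \<psi> = ((\<phi> + tail \<phi>) - (\<psi> + tail \<psi>)) + - (tail \<phi> - tail \<psi>)"
    by simp
  then have "vec_norm_inf (\<phi> - \<psi>) \<le>
      vec_norm_inf ((\<phi> + tail \<phi>) - (\<psi> + tail \<psi>)) + vec_norm_inf (tail \<phi> - tail \<psi>)"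
    by (metis vec_norm_inf_add_le vec_norm_inf_minus)
  then show ?thesis
    using tail_lipschitz[OF assms] by (simp add: algebra_simps)
qed

lemma edge_balance_injective:
  assumes "vec_norm_inf \<phi> \<le> R" "vec_norm_inf \<psi> \<le> R" "\<phi> + tail \<phi> = \<psi> + tail \<psi>"
  shows "\<phi> = \<psi>"
proof -
  have "(1 - q) * vec_norm_inf (\<phi> - \<psi>) \<le> 0"
    using inverse_lipschitz[OF assms(1,2)] assms(3) by (simp add: vec_norm_inf_eq_0_iff[THEN iffD2])
  then have "vec_norm_inf (\<phi> - \<psi>) \<le> 0"
    using q_bounds by (simp add: mult_le_0_iff)
  then show ?thesis
    using vec_norm_inf_eq_0_iff[of "\<phi> - \<psi>"] vec_norm_inf_nonneg[of "\<phi> - \<psi>"] by auto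
qed

text \<open>Brouwer's theorem suffices for existence; the contraction property gives uniqueness.\<close>

lemma edge_balance_surjective:
  assumes "vec_norm_inf \<xi> < radius"
  obtains \<phi> where "vec_norm_inf \<phi> < R" "\<phi> + tail \<phi> = \<xi>"
proof -
  have bound: "vec_norm_inf (\<xi> - tail \<phi>) < R" if "vec_norm_inf \<phi> \<le> R" for \<phi>
  proof -
    have "vec_norm_inf (\<xi> - tail \<phi>) \<le> vec_norm_inf \<xi> + vec_norm_inf (tail \<phi>)"
      using vec_norm_inf_add_le[of \<xi> "- tail \<phi>"] by (simp add: vec_norm_inf_minus)
    then show ?thesis
      using vec_norm_inf_tail_le[OF that] assms by (simp add: radius_def)
  qed
  have cont: "continuous_on (ball 0 1) (arcsin_tail :: complex \<Rightarrow> complex)"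
    by (rule DERIV_continuous_on[OF has_field_derivative_at_within[OF arcsin_tail_has_derivative]]) simp
  have "continuous_on (polydisk 0 R) (\<lambda>\<phi>. \<xi> - tail \<phi>)"
    unfolding tail_def cmat_def matrix_vector_mult_def
    using R_less_1
    by (auto simp: mem_polydisk_0 vec_norm_inf_le_iff intro!: continuous_intros
        continuous_on_compose2[OF cont] elim!: le_less_trans[rotated])
  moreover have "(0 :: complex^'m) \<in> polydisk 0 R"
    using R_pos by (simp add: mem_polydisk_0 vec_norm_inf_le_iff)
  then have "polydisk 0 R \<noteq> ({} :: (complex^'m) set)"
    by blast
  moreover have "(\<lambda>\<phi>. \<xi> - tail \<phi>) \<in> polydisk 0 R \<rightarrow> polydisk 0 R"
    using bound by (auto simp: mem_polydisk_0 less_imp_le)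
  ultimately obtain \<phi> where "\<phi> \<in> polydisk 0 R" "\<xi> - tail \<phi> = \<phi>"
    using brouwer[OF compact_polydisk convex_polydisk] by metis
  then show ?thesis
    using that[of \<phi>] bound[of \<phi>] by (auto simp: mem_polydisk_0 algebra_simps)
qed

text \<open>The inverse of \<open>\<lambda>\<phi>. \<phi> + tail \<phi>\<close>; meaningful for arguments of norm less than \<open>radius\<close>.\<close>

definition inv_map :: "complex^'m \<Rightarrow> complex^'m" where
  "inv_map \<xi> = (SOME \<phi>. vec_norm_inf \<phi> < R \<and> \<phi> + tail \<phi> = \<xi>)"

lemma inv_map:
  assumes "vec_norm_inf \<xi> < radius"
  shows "vec_norm_inf (inv_map \<xi>) < R" "inv_map \<xi> + tail (inv_map \<xi>) = \<xi>"
proof -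
  have "\<exists>\<phi>. vec_norm_inf \<phi> < R \<and> \<phi> + tail \<phi> = \<xi>"
    using edge_balance_surjective[OF assms] by metis
  from someI_ex[OF this] show "vec_norm_inf (inv_map \<xi>) < R" "inv_map \<xi> + tail (inv_map \<xi>) = \<xi>"
    by (auto simp: inv_map_def)
qed

lemma inv_map_eqI:
  assumes "vec_norm_inf \<phi> \<le> R" "\<phi> + tail \<phi> = \<xi>" "vec_norm_inf \<xi> < radius"
  shows "inv_map \<xi> = \<phi>"
  by (rule edge_balance_injective[OF _ assms(1)]) (use assms(2) inv_map[OF assms(3)] in simp_all)

lemma open_domain: "open {\<xi> :: complex^'m. vec_norm_inf \<xi> < r}"
proof -
  have "open {w :: complex^'m. w $ i \<in> ball 0 r}" for i
    using continuous_open_vimage[of "ball 0 r" "\<lambda>w :: complex^'m. w $ i"]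
    by (auto simp: vimage_def intro!: continuous_intros)
  moreover have "{\<xi> :: complex^'m. vec_norm_inf \<xi> < r} = (\<Inter>i. {w. w $ i \<in> ball 0 r})"
    by (auto simp: vec_norm_inf_less_iff)
  ultimately show ?thesis
    by (auto intro!: open_INT)
qed

lemma continuous_on_inv_map: "continuous_on {\<xi>. vec_norm_inf \<xi> < radius} inv_map"
proof (rule lipschitz_on_continuous_on[OF lipschitz_onI])
  fix \<xi> \<zeta> :: "complex^'m"
  assume "\<xi> \<in> {\<xi>. vec_norm_inf \<xi> < radius}" "\<zeta> \<in> {\<xi>. vec_norm_inf \<xi> < radius}"
  then have *: "vec_norm_inf \<xi> < radius" "vec_norm_inf \<zeta> < radius"
    by auto
  have "(1 - q) * vec_norm_inf (inv_map \<xi> - inv_map \<zeta>) \<le> vec_norm_inf (\<xi> - \<zeta>)"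
    using inverse_lipschitz[of "inv_map \<xi>" "inv_map \<zeta>"] inv_map[OF *(1)] inv_map[OF *(2)] by simp
  then have "vec_norm_inf (inv_map \<xi> - inv_map \<zeta>) \<le> vec_norm_inf (\<xi> - \<zeta>) / (1 - q)"
    using q_bounds by (simp add: field_simps)
  also have "\<dots> \<le> norm (\<xi> - \<zeta>) / (1 - q)"
    using q_bounds by (intro divide_right_mono vec_norm_inf_le_norm) auto
  finally have "CARD('m) * vec_norm_inf (inv_map \<xi> - inv_map \<zeta>) \<le> CARD('m) * (norm (\<xi> - \<zeta>) / (1 - q))"
    by (intro mult_left_mono) auto
  then show "dist (inv_map \<xi>) (inv_map \<zeta>) \<le> CARD('m) / (1 - q) * dist \<xi> \<zeta>"
    using norm_le_vec_norm_inf[of "inv_map \<xi> - inv_map \<zeta>"] by (simp add: dist_norm)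
qed (use q_bounds in auto)

text \<open>The complex Jacobian matrix of \<open>\<lambda>\<phi>. \<phi> + tail \<phi>\<close>, that is, the identity plus \<open>P\<close> times the
  diagonal matrix of the derivatives of \<open>arcsin_tail\<close>.\<close>

definition jacobian :: "complex^'m \<Rightarrow> complex^'m^'m" where
  "jacobian \<phi> = (\<chi> i j. (if i = j then 1 else 0) +
     of_real (P $ i $ j) * eval_fps (fps_deriv arcsin_tail_fps) (\<phi> $ j))"

lemma jacobian_mult:
  "jacobian \<phi> *v v = v + cmat P *v (\<chi> j. eval_fps (fps_deriv arcsin_tail_fps) (\<phi> $ j) * v $ j)"
  by (simp add: vec_eq_iff jacobian_def matrix_vector_mult_def cmat_def distrib_right sum.distrib
      mult.assoc if_distrib[of "\<lambda>x. x * _"] cong: if_cong)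

lemma has_derivative_edge_balance:
  assumes "vec_norm_inf \<phi> < 1"
  shows "((\<lambda>\<phi>. \<phi> + tail \<phi>) has_derivative (\<lambda>v. jacobian \<phi> *v v)) (at \<phi>)"
proof -
  have "((\<lambda>\<phi>. arcsin_tail (\<phi> $ j)) has_derivative
      (\<lambda>v. eval_fps (fps_deriv arcsin_tail_fps) (\<phi> $ j) * v $ j)) (at \<phi>)" for j
  proof -
    have "(arcsin_tail has_derivative (*) (eval_fps (fps_deriv arcsin_tail_fps) (\<phi> $ j))) (at (\<phi> $ j))"
      using arcsin_tail_has_derivative[of "\<phi> $ j"] assms
      by (simp add: vec_norm_inf_less_iff has_field_derivative_def)
    from has_derivative_compose[OF bounded_linear.has_derivative[OF bounded_linear_vec_nth has_derivative_ident] this]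
    show ?thesis .
  qed
  then have "((\<lambda>\<phi>. \<chi> j. arcsin_tail (\<phi> $ j)) has_derivative
      (\<lambda>v. \<chi> j. eval_fps (fps_deriv arcsin_tail_fps) (\<phi> $ j) * v $ j)) (at \<phi>)"
    by (rule has_derivative_vec_lambda)
  from bounded_linear.has_derivative[OF matrix_vector_mul_bounded_linear this]
  show ?thesis
    unfolding jacobian_mult tail_def by (intro has_derivative_add has_derivative_ident)
qed

text \<open>By the bound \<open>q < 1\<close> the Jacobian matrix differs from the identity by a strict contraction.\<close>

lemma jacobian_left_inverse:
  assumes "vec_norm_inf \<phi> \<le> R"
  obtains K where "K ** jacobian \<phi> = mat 1"
proof -
  have "v = 0" if v: "jacobian \<phi> *v v = 0" for v
  proof -
    define w where "w = (\<chi> j. eval_fps (fps_deriv arcsin_tail_fps) (\<phi> $ j) * v $ j)"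
    define L where "L = 1 / sqrt (1 - R\<^sup>2) - 1"
    have "norm (w $ j) \<le> L * vec_norm_inf v" for j
    proof -
      have "norm (eval_fps (fps_deriv arcsin_tail_fps) (\<phi> $ j)) \<le> L"
        using assms R_less_1 norm_deriv_arcsin_tail_le[of "\<phi> $ j" R]
        by (simp add: L_def vec_norm_inf_le_iff)
      moreover from this have "0 \<le> L"
        using norm_ge_zero order_trans by blast
      ultimately show ?thesis
        unfolding w_def by (auto simp: norm_mult intro!: mult_mono norm_nth_le_vec_norm_inf)
    qed
    then have "vec_norm_inf w \<le> L * vec_norm_inf v"
      by (simp add: vec_norm_inf_le_iff)
    then have "N * vec_norm_inf w \<le> N * (L * vec_norm_inf v)"
      using N_nonneg by (rule mult_left_mono)
    moreover have "v = - (cmat P *v w)"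
      using v unfolding jacobian_mult w_def by (simp add: eq_neg_iff_add_eq_0)
    then have "vec_norm_inf v = vec_norm_inf (cmat P *v w)"
      by (metis vec_norm_inf_minus)
    moreover have "vec_norm_inf (cmat P *v w) \<le> N * vec_norm_inf w"
      by (intro vec_norm_inf_cmat_mult_le row_sum)
    ultimately have "(1 - q) * vec_norm_inf v \<le> 0"
      by (simp add: q_def L_def algebra_simps)
    then have "vec_norm_inf v \<le> 0"
      using q_bounds by (simp add: mult_le_0_iff)
    then show ?thesis
      using vec_norm_inf_eq_0_iff[of v] vec_norm_inf_nonneg[of v] by auto
  qed
  then show ?thesis
    using that matrix_left_invertible_ker[of "jacobian \<phi>"] by blast
qed

lemma has_derivative_inv_map:
  assumes "vec_norm_inf \<xi> < radius"
  obtains K where "(inv_map has_derivative (\<lambda>v. K *v v)) (at \<xi>)"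
proof -
  obtain K where K: "K ** jacobian (inv_map \<xi>) = mat 1"
    using jacobian_left_inverse[of "inv_map \<xi>"] inv_map(1)[OF assms] by auto
  have "(inv_map has_derivative (\<lambda>v. K *v v)) (at \<xi>)"
  proof (rule has_derivative_inverse_basic)
    show "((\<lambda>\<phi>. \<phi> + tail \<phi>) has_derivative (\<lambda>v. jacobian (inv_map \<xi>) *v v)) (at (inv_map \<xi>))"
      using inv_map(1)[OF assms] R_less_1 by (intro has_derivative_edge_balance) auto
    show "(*v) K \<circ> (*v) (jacobian (inv_map \<xi>)) = id"
      using K by (simp add: fun_eq_iff matrix_vector_mul_assoc)
    show "continuous (at \<xi>) inv_map"
      using continuous_on_inv_map open_domain assms by (auto simp: continuous_on_eq_continuous_at)
    show "open {\<xi> :: complex^'m. vec_norm_inf \<xi> < radius}"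
      by (rule open_domain)
  qed (use assms inv_map in auto)
  then show ?thesis
    by (rule that)
qed

end

section \<open>The recursion as an identity of formal power series\<close>

lemma odd_tuples_subset_natpermute: "odd_tuples m n \<subseteq> natpermute n m"
  by (auto simp: odd_tuples_def natpermute_def)

lemma length_le_sum_list_odd:
  "(\<And>\<alpha>. \<alpha> \<in> set \<alpha>s \<Longrightarrow> odd \<alpha>) \<Longrightarrow> length \<alpha>s \<le> sum_list \<alpha>s" for \<alpha>s :: "nat list"
  by (induction \<alpha>s) (auto simp: Suc_le_eq intro!: add_less_le_mono[of 0 _ "length _" "sum_list _", simplified] odd_pos)

lemma even_sum_list_odd_iff:
  "(\<And>\<alpha>. \<alpha> \<in> set \<alpha>s \<Longrightarrow> odd \<alpha>) \<Longrightarrow> even (sum_list \<alpha>s) \<longleftrightarrow> even (length \<alpha>s)" for \<alpha>s :: "nat list"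
  by (induction \<alpha>s) auto

lemma odd_tuples_eq_empty:
  assumes "n < m \<or> (even n \<noteq> even m)"
  shows "odd_tuples m n = {}"
  using assms length_le_sum_list_odd even_sum_list_odd_iff by (fastforce simp: odd_tuples_def)

lemma prod_list_nth: "prod_list xs $ j = prod_list (map (\<lambda>x. x $ j) xs)"
  for xs :: "('a::monoid_mult^'m) list"
  by (induction xs) auto

lemma of_real_prod_list: "of_real (prod_list xs) = (prod_list (map of_real xs) :: 'a::real_algebra_1)"
  by (induction xs) auto

text \<open>A uniform version of the recursion: the inner sum is empty for the
  additional values of \<open>k\<close>, for \<open>n \<le> 1\<close> and for even \<open>n\<close>.\<close>

lemma series_term_nth:
  "series_term P n x $ i = (if n = 1 then x $ i else 0) -
     (\<Sum>j\<in>UNIV. P $ i $ j * (\<Sum>k=1..n. arcsin_coeff k *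
        (\<Sum>\<alpha>s\<in>odd_tuples (2 * k + 1) n. prod_list (map (\<lambda>\<alpha>. series_term P \<alpha> x $ j) \<alpha>s))))"
  (is "_ = _ - (\<Sum>j\<in>UNIV. P $ i $ j * (\<Sum>k=1..n. ?S j k))")
proof (cases "odd n \<and> n \<noteq> 1")
  case True
  have "?S j k = 0" if "k \<in> {1..n} - {1..(n - 1) div 2}" for j k
  proof -
    have "n < 2 * k + 1"
      using that by auto
    then have "odd_tuples (2 * k + 1) n = {}"
      by (intro odd_tuples_eq_empty) auto
    then show ?thesis
      by (simp only: sum.empty mult_zero_right)
  qed
  then have "(\<Sum>k=1..n. ?S j k) = (\<Sum>k=1..(n - 1) div 2. ?S j k)" for j
    by (intro sum.mono_neutral_right) auto
  moreover have "series_term P n x $ i = - (\<Sum>j\<in>UNIV. P $ i $ j * (\<Sum>k=1..(n - 1) div 2. ?S j k))"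
    using True by (subst series_term.simps)
      (simp add: matrix_vector_mult_def prod_list_nth o_def)
  ultimately show ?thesis
    using True by simp
next
  case False
  have "?S j k = 0" if "k \<in> {1..n}" for j k
  proof -
    have "n < 2 * k + 1 \<or> even n \<noteq> even (2 * k + 1)"
      using that False by auto
    then have "odd_tuples (2 * k + 1) n = {}"
      by (intro odd_tuples_eq_empty) auto
    then show ?thesis
      by (simp only: sum.empty mult_zero_right)
  qed
  then have "(\<Sum>k=1..n. ?S j k) = 0" for j
    by (intro sum.neutral) blast
  moreover have "series_term P n x $ i = (if n = 1 then x $ i else 0)"
    using False by (subst series_term.simps) auto
  ultimately show ?thesis
    by (simp only: mult_zero_right sum.neutral_const diff_zero)
qed

lemma series_term_even: "even n \<Longrightarrow> series_term P n x = 0"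
  by (subst series_term.simps) (auto simp: odd_pos)

text \<open>In the coefficients of an odd function only odd tuples contribute. As \<open>m \<ge> 2\<close>, all parts of a
  composition of \<open>n\<close> into \<open>m\<close> positive parts are below \<open>n\<close>, so nothing is needed about \<open>fps_nth B n\<close>.\<close>

lemma fps_power_nth_odd_tuples:
  fixes B :: "'a::comm_ring_1 fps"
  assumes "m \<ge> 2" "fps_nth B 0 = 0" "\<And>k. k < n \<Longrightarrow> even k \<Longrightarrow> fps_nth B k = 0"
  shows "fps_nth (B ^ m) n = (\<Sum>\<alpha>s\<in>odd_tuples m n. prod_list (map (fps_nth B) \<alpha>s))"
proof -
  have "fps_nth (B ^ m) n = (\<Sum>v\<in>natpermute n m. \<Prod>j\<in>{0..m - 1}. fps_nth B (v ! j))"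
    using assms(1) by (simp add: fps_power_nth)
  also have "\<dots> = (\<Sum>v\<in>natpermute n m. prod_list (map (fps_nth B) v))"
  proof (intro sum.cong refl)
    fix v
    assume "v \<in> natpermute n m"
    then have "{0..m - 1} = {0..<length (map (fps_nth B) v)}"
      using assms(1) by (auto simp: natpermute_def)
    then show "(\<Prod>j\<in>{0..m - 1}. fps_nth B (v ! j)) = prod_list (map (fps_nth B) v)"
      by (simp add: prod.list_conv_set_nth)
  qed
  also have "\<dots> = (\<Sum>\<alpha>s\<in>odd_tuples m n. prod_list (map (fps_nth B) \<alpha>s))"
  proof (intro sum.mono_neutral_right odd_tuples_subset_natpermute natpermute_finite ballI)
    fix v
    assume v: "v \<in> natpermute n m - odd_tuples m n"
    then obtain k where k: "k \<in> set v" "even k"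
      by (auto simp: natpermute_def odd_tuples_def)
    have "\<exists>k\<in>set v. fps_nth B k = 0"
    proof (cases "0 \<in> set v")
      case False
      obtain xs ys where v': "v = xs @ k # ys"
        using split_list[OF k(1)] by blast
      have "length (xs @ ys) = m - 1"
        using v v' by (auto simp: natpermute_def)
      then have "xs @ ys \<noteq> []"
        using assms(1) by auto
      then obtain b where b: "b \<in> set (xs @ ys)"
        using hd_in_set by blast
      then have "b > 0"
        using False v' by (metis Un_iff gr0I insertCI list.simps(15) set_append)
      moreover have "b \<le> sum_list (xs @ ys)"
        using b by (intro member_le_sum_list) auto
      moreover have "n = k + sum_list (xs @ ys)"
        using v v' by (auto simp: natpermute_def)
      ultimately have "k < n"
        by linarith
      then show ?thesis
        using assms(3) k by blast
    qed (use assms(2) in blast)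
    then have "0 \<in> set (map (fps_nth B) v)"
      by (metis image_eqI set_map)
    then show "prod_list (map (fps_nth B) v) = 0"
      by (induction v) auto
  qed
  finally show ?thesis .
qed

lemma arcsin_tail_compose_nth:
  fixes B :: "'a::{banach, real_normed_field} fps"
  assumes "fps_nth B 0 = 0" "\<And>k. k < n \<Longrightarrow> even k \<Longrightarrow> fps_nth B k = 0"
  shows "fps_nth (arcsin_tail_fps oo B) n = (\<Sum>k=1..n. of_real (arcsin_coeff k) *
           (\<Sum>\<alpha>s\<in>odd_tuples (2 * k + 1) n. prod_list (map (fps_nth B) \<alpha>s)))"
proof -
  let ?f = "\<lambda>m. fps_nth arcsin_tail_fps m * fps_nth (B ^ m) n"
  let ?g = "\<lambda>k::nat. 2 * k + 1"
  have "fps_nth (arcsin_tail_fps oo B) n = sum ?f {0..n}"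
    by (rule fps_compose_nth)
  also have "\<dots> = sum ?f {0..2 * n + 1}"
    using startsby_zero_power_prefix[OF assms(1)] by (intro sum.mono_neutral_left) auto
  also have "\<dots> = sum ?f (?g ` {1..n})"
    by (intro sum.mono_neutral_right) (auto simp: arcsin_tail_fps_def image_iff elim!: oddE)
  also have "\<dots> = (\<Sum>k=1..n. ?f (2 * k + 1))"
    by (subst sum.reindex) (auto simp: inj_on_def)
  also have "\<dots> = (\<Sum>k=1..n. of_real (arcsin_coeff k) *
           (\<Sum>\<alpha>s\<in>odd_tuples (2 * k + 1) n. prod_list (map (fps_nth B) \<alpha>s)))"
  proof (intro sum.cong refl)
    fix k
    assume k: "k \<in> {1..n}"
    then have "fps_nth (B ^ (2 * k + 1)) n =
        (\<Sum>\<alpha>s\<in>odd_tuples (2 * k + 1) n. prod_list (map (fps_nth B) \<alpha>s))"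
      using assms by (intro fps_power_nth_odd_tuples) auto
    moreover have "fps_nth arcsin_tail_fps (2 * k + 1) = (of_real (arcsin_coeff k) :: 'a)"
      using k by (simp add: arcsin_tail_fps_def)
    ultimately show "?f (2 * k + 1) = of_real (arcsin_coeff k) *
        (\<Sum>\<alpha>s\<in>odd_tuples (2 * k + 1) n. prod_list (map (fps_nth B) \<alpha>s))"
      by (simp only:)
  qed
  finally show ?thesis .
qed

text \<open>Uniqueness of the formal solution of \<open>\<Psi> + P (arcsin \<Psi> - \<Psi>) = X * \<eta>\<close>.\<close>

lemma formal_solution_nth:
  fixes \<Psi> :: "'m::finite \<Rightarrow> complex fps" and P :: "real^'m^'m"
  assumes eq: "\<And>i. \<Psi> i + (\<Sum>j\<in>UNIV. fps_const (of_real (P $ i $ j)) * (arcsin_tail_fps oo \<Psi> j)) =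
                 fps_X * fps_const (of_real (\<eta> $ i))"
  shows "fps_nth (\<Psi> i) n = of_real (series_term P n \<eta> $ i)"
proof -
  have rec: "fps_nth (\<Psi> i) n = (if n = 1 then of_real (\<eta> $ i) else 0) -
      (\<Sum>j\<in>UNIV. of_real (P $ i $ j) * fps_nth (arcsin_tail_fps oo \<Psi> j) n)" for i n
  proof -
    have "fps_nth (\<Psi> i) n + (\<Sum>j\<in>UNIV. of_real (P $ i $ j) * fps_nth (arcsin_tail_fps oo \<Psi> j) n) =
        fps_nth (fps_X * fps_const (of_real (\<eta> $ i))) n"
      using arg_cong[OF eq[of i], of "\<lambda>F. fps_nth F n"] by (simp add: fps_sum_nth)
    then show ?thesis
      by (cases n) (auto simp: eq_diff_eq eq_neg_iff_add_eq_0)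
  qed
  have 0: "fps_nth (\<Psi> i) 0 = 0" for i
    using rec[of i 0] by (simp add: arcsin_tail_fps_def)
  show ?thesis
  proof (induction n arbitrary: i rule: less_induct)
    case (less n)
    have "fps_nth (\<Psi> j) k = 0" if "k < n" "even k" for j k
      using less.IH[OF that(1)] that(2) by (simp add: series_term_even)
    then have "fps_nth (arcsin_tail_fps oo \<Psi> j) n = (\<Sum>k=1..n. of_real (arcsin_coeff k) *
           (\<Sum>\<alpha>s\<in>odd_tuples (2 * k + 1) n. prod_list (map (fps_nth (\<Psi> j)) \<alpha>s)))" for j
      using 0 by (intro arcsin_tail_compose_nth) auto
    also have "\<dots> j = (\<Sum>k=1..n. of_real (arcsin_coeff k) *
           (\<Sum>\<alpha>s\<in>odd_tuples (2 * k + 1) n. of_real (prod_list (map (\<lambda>\<alpha>. series_term P \<alpha> \<eta> $ j) \<alpha>s))))" for j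
    proof (intro sum.cong refl arg_cong2[of _ _ _ _ "(*)"])
      fix k \<alpha>s
      assume *: "k \<in> {1..n}" "\<alpha>s \<in> odd_tuples (2 * k + 1) n"
      then have "map (fps_nth (\<Psi> j)) \<alpha>s = map (\<lambda>\<alpha>. complex_of_real (series_term P \<alpha> \<eta> $ j)) \<alpha>s"
        using less.IH odd_tuples_less[of k \<alpha>s n] by (intro map_cong) auto
      then show "prod_list (map (fps_nth (\<Psi> j)) \<alpha>s) =
          of_real (prod_list (map (\<lambda>\<alpha>. series_term P \<alpha> \<eta> $ j) \<alpha>s))"
        by (simp only: of_real_prod_list map_map o_def)
    qed
    finally show ?case
      by (simp add: rec series_term_nth[of P n])
  qed
qed

context edge_balance_contraction
begin

text \<open>The complex line through \<open>\<eta>\<close> reduces the expansion of the inverse to one variable.\<close>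

lemma inv_map_slice_holomorphic:
  assumes "\<And>t. t \<in> S \<Longrightarrow> norm t * vec_norm_inf \<eta> < radius"
  shows "(\<lambda>t. inv_map (t *s cvec \<eta>) $ e) holomorphic_on S"
proof -
  have "\<exists>D. ((\<lambda>t. inv_map (t *s cvec \<eta>) $ e) has_field_derivative D) (at t)" if "t \<in> S" for t
  proof -
    have "vec_norm_inf (t *s cvec \<eta>) < radius"
      using vec_norm_inf_scale_le[of t "cvec \<eta>"] assms[OF that] by (simp add: vec_norm_inf_cvec)
    then obtain K where K: "(inv_map has_derivative (\<lambda>v. K *v v)) (at (t *s cvec \<eta>))"
      by (rule has_derivative_inv_map)
    have "((\<lambda>t. t *s cvec \<eta>) has_derivative (\<lambda>u. u *s cvec \<eta>)) (at t)"
      unfolding vector_scalar_mult_def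
      by (intro has_derivative_vec_lambda has_derivative_mult_left has_derivative_ident)
    from has_derivative_compose[OF this K]
    have "((\<lambda>t. inv_map (t *s cvec \<eta>) $ e) has_derivative (\<lambda>u. (K *v (u *s cvec \<eta>)) $ e)) (at t)"
      by (rule bounded_linear.has_derivative[OF bounded_linear_vec_nth])
    moreover have "(\<lambda>u. (K *v (u *s cvec \<eta>)) $ e) = (*) ((K *v cvec \<eta>) $ e)"
      by (simp add: fun_eq_iff vector_scalar_commute mult.commute)
    ultimately show ?thesis
      by (auto simp: has_field_derivative_def)
  qed
  then show ?thesis
    by (meson field_differentiable_at_within field_differentiable_def holomorphic_on_def)
qed

lemma series_term_sums_inv_map:
  assumes "vec_norm_inf \<eta> < radius"
  shows "(\<lambda>n. of_real (series_term P n \<eta> $ e)) sums (inv_map (cvec \<eta>) $ e)"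
proof -
  define \<psi> where "\<psi> e t = inv_map (t *s cvec \<eta>) $ e" for e t
  define s where "s = vec_norm_inf \<eta>"
  have s: "0 \<le> s" "s < radius"
    using assms vec_norm_inf_nonneg by (auto simp: s_def)
  \<comment> \<open>A disk that contains \<open>1\<close> in its interior and on which the line stays in the domain of the inverse.\<close>
  obtain \<rho> where \<rho>: "\<rho> > 1" "\<rho> * s < radius"
  proof (cases "s = 0")
    case True
    then show ?thesis
      using that[of 2] s by simp
  next
    case False
    with s show ?thesis
      by (intro that[of "(1 + radius / s) / 2"]) (auto simp: field_simps)
  qed
  have dom: "norm t * vec_norm_inf \<eta> < radius" if "t \<in> ball 0 \<rho>" for t :: complex
    using that \<rho>(2) s(1) mult_right_mono[of "norm t" \<rho> s] by (simp add: s_def)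
  have hol: "\<psi> e holomorphic_on ball 0 \<rho>" for e
    unfolding \<psi>_def using dom by (rule inv_map_slice_holomorphic)
  define \<Psi> where "\<Psi> e = fps_expansion (\<psi> e) 0" for e
  have exp: "\<psi> e has_fps_expansion \<Psi> e" for e
    unfolding \<Psi>_def using \<rho> by (intro has_fps_expansion_fps_expansion[OF _ _ hol]) auto
  have "\<psi> e 0 = 0" for e
  proof -
    have "inv_map 0 = 0"
      using s R_pos by (intro inv_map_eqI)
        (auto simp: vec_norm_inf_eq_0_iff[THEN iffD2] tail_0)
    then show ?thesis
      by (simp add: \<psi>_def)
  qed
  then have \<Psi>0: "fps_nth (\<Psi> e) 0 = 0" for e
    by (simp add: \<Psi>_def fps_expansion_def)
  have "\<Psi> i + (\<Sum>j\<in>UNIV. fps_const (of_real (P $ i $ j)) * (arcsin_tail_fps oo \<Psi> j)) =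
      fps_X * fps_const (of_real (\<eta> $ i))" (is "?lhs = ?rhs") for i
  proof -
    have tail_exp: "(arcsin_tail :: complex \<Rightarrow> complex) has_fps_expansion arcsin_tail_fps"
      using arcsin_tail_conv_radius[where 'a = complex]
      by (intro eval_fps_has_fps_expansion) (auto intro: less_le_trans[of 0 1])
    have lhs: "(\<lambda>t. \<psi> i t + (\<Sum>j\<in>UNIV. of_real (P $ i $ j) * (arcsin_tail \<circ> \<psi> j) t)) has_fps_expansion ?lhs"
      by (intro fps_expansion_intros exp \<Psi>0 tail_exp)
    have "\<psi> i t + (\<Sum>j\<in>UNIV. of_real (P $ i $ j) * (arcsin_tail \<circ> \<psi> j) t) = t * of_real (\<eta> $ i)"
      if "t \<in> ball 0 \<rho>" for t
    proof -
      have "vec_norm_inf (t *s cvec \<eta>) < radius"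
        using vec_norm_inf_scale_le[of t "cvec \<eta>"] dom[OF that] by (simp add: vec_norm_inf_cvec)
      then have "(inv_map (t *s cvec \<eta>) + tail (inv_map (t *s cvec \<eta>))) $ i = (t *s cvec \<eta>) $ i"
        using inv_map(2)[of "t *s cvec \<eta>"] by simp
      then show ?thesis
        by (simp add: \<psi>_def tail_nth cvec_def)
    qed
    then have ev: "eventually (\<lambda>t. \<psi> i t + (\<Sum>j\<in>UNIV. of_real (P $ i $ j) * (arcsin_tail \<circ> \<psi> j) t) =
        t * of_real (\<eta> $ i)) (nhds 0)"
      using \<rho> by (intro eventually_nhds_in_open[of "ball 0 \<rho>", THEN eventually_mono]) auto
    have "(\<lambda>t. t * of_real (\<eta> $ i)) has_fps_expansion ?lhs"
      by (rule iffD1[OF has_fps_expansion_cong[OF ev refl] lhs])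
    moreover have "(\<lambda>t. t * of_real (\<eta> $ i)) has_fps_expansion ?rhs"
      by (intro fps_expansion_intros)
    ultimately show ?thesis
      using fps_expansion_eqI by metis
  qed
  then have "fps_nth (\<Psi> e) n = of_real (series_term P n \<eta> $ e)" for n
    by (rule formal_solution_nth)
  moreover have "(\<lambda>n. fps_nth (\<Psi> e) n * 1 ^ n) sums \<psi> e 1"
    using exp \<rho> hol by (intro has_fps_expansion_imp_sums_complex[where r = \<rho>]) auto
  ultimately show ?thesis
    by (simp add: \<psi>_def)
qed

end

section \<open>Majorants of homogeneous polynomials\<close>

lemma homogeneous_polynomial_nth:
  "homogeneous_polynomial d c x $ e = homogeneous_polynomial d (\<lambda>\<nu>. c \<nu> $ e) x"
  by (simp add: homogeneous_polynomial_def)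

lemma homogeneous_polynomial_cong:
  "(\<And>\<nu>. multi_degree \<nu> = d \<Longrightarrow> c \<nu> = c' \<nu>) \<Longrightarrow> homogeneous_polynomial d c x = homogeneous_polynomial d c' x"
  by (simp add: homogeneous_polynomial_def)

lemma monomial_add: "monomial x (\<lambda>e. \<mu> e + \<nu> e) = monomial x \<mu> * monomial x \<nu>"
  by (simp add: monomial_def power_add prod.distrib)

lemma multi_degree_add: "multi_degree (\<lambda>e. \<mu> e + \<nu> e) = multi_degree \<mu> + multi_degree \<nu>"
  by (simp add: multi_degree_def sum.distrib)

lemma abs_monomial: "\<bar>monomial x \<nu>\<bar> = monomial (\<chi> e. \<bar>x $ e\<bar>) \<nu>"
  by (simp add: monomial_def abs_prod power_abs)

text \<open>\<open>f\<close> and \<open>F\<close> are homogeneous of degree \<open>d\<close>, and the coefficients of \<open>F\<close> bound those of \<open>f\<close>.\<close>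

definition hom_majorized :: "nat \<Rightarrow> (real^'m \<Rightarrow> real) \<Rightarrow> (real^'m \<Rightarrow> real) \<Rightarrow> bool" where
  "hom_majorized d f F \<longleftrightarrow> (\<exists>c C. (\<forall>x. f x = homogeneous_polynomial d c x) \<and>
     (\<forall>x. F x = homogeneous_polynomial d C x) \<and> (\<forall>\<nu>. \<bar>c \<nu>\<bar> \<le> C \<nu>))"

lemma hom_majorized_zero: "hom_majorized d (\<lambda>x. 0) (\<lambda>x. 0)"
  unfolding hom_majorized_def by (intro exI[of _ "\<lambda>_. 0"]) (simp add: homogeneous_polynomial_def)

lemma hom_majorized_add:
  assumes "hom_majorized d f F" "hom_majorized d g G"
  shows "hom_majorized d (\<lambda>x. f x + g x) (\<lambda>x. F x + G x)"
proof -
  obtain c C where 1: "\<And>x. f x = homogeneous_polynomial d c x" "\<And>x. F x = homogeneous_polynomial d C x"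
    "\<And>\<nu>. \<bar>c \<nu>\<bar> \<le> C \<nu>"
    using assms(1) by (auto simp: hom_majorized_def)
  obtain b D where 2: "\<And>x. g x = homogeneous_polynomial d b x" "\<And>x. G x = homogeneous_polynomial d D x"
    "\<And>\<nu>. \<bar>b \<nu>\<bar> \<le> D \<nu>"
    using assms(2) by (auto simp: hom_majorized_def)
  show ?thesis
    unfolding hom_majorized_def
  proof (rule exI[of _ "\<lambda>\<nu>. c \<nu> + b \<nu>"], rule exI[of _ "\<lambda>\<nu>. C \<nu> + D \<nu>"], intro conjI allI)
    show "\<bar>c \<nu> + b \<nu>\<bar> \<le> C \<nu> + D \<nu>" for \<nu>
      using 1(3)[of \<nu>] 2(3)[of \<nu>] by linarith
  qed (simp_all add: 1 2 homogeneous_polynomial_def sum.distrib distrib_left)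
qed

lemma hom_majorized_sum:
  assumes "\<And>i. i \<in> I \<Longrightarrow> hom_majorized d (f i) (F i)"
  shows "hom_majorized d (\<lambda>x. \<Sum>i\<in>I. f i x) (\<lambda>x. \<Sum>i\<in>I. F i x)"
  using assms
  by (induction I rule: infinite_finite_induct) (auto intro: hom_majorized_zero hom_majorized_add)

lemma hom_majorized_scale:
  assumes "hom_majorized d f F"
  shows "hom_majorized d (\<lambda>x. r * f x) (\<lambda>x. \<bar>r\<bar> * F x)"
proof -
  obtain c C where 1: "\<And>x. f x = homogeneous_polynomial d c x" "\<And>x. F x = homogeneous_polynomial d C x"
    "\<And>\<nu>. \<bar>c \<nu>\<bar> \<le> C \<nu>"
    using assms(1) by (auto simp: hom_majorized_def)
  show ?thesis
    unfolding hom_majorized_def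
  proof (rule exI[of _ "\<lambda>\<nu>. r * c \<nu>"], rule exI[of _ "\<lambda>\<nu>. \<bar>r\<bar> * C \<nu>"], intro conjI allI)
    show "\<bar>r * c \<nu>\<bar> \<le> \<bar>r\<bar> * C \<nu>" for \<nu>
      using 1(3)[of \<nu>] by (simp add: abs_mult mult_left_mono)
  qed (simp_all add: 1 homogeneous_polynomial_def sum_distrib_left mult_ac)
qed

lemma multi_degree_eq_0_iff: "multi_degree \<nu> = 0 \<longleftrightarrow> \<nu> = (\<lambda>_. 0)"
  by (auto simp: multi_degree_def fun_eq_iff)

lemma hom_majorized_one: "hom_majorized 0 (\<lambda>x. 1) (\<lambda>x. 1)"
  unfolding hom_majorized_def
  by (intro exI[of _ "\<lambda>_. 1"]) (simp add: homogeneous_polynomial_def multi_degree_eq_0_iff monomial_def)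

lemma hom_majorized_coordinate: "hom_majorized 1 (\<lambda>x. x $ i) (\<lambda>x. x $ i)"
proof -
  define \<delta> :: "'a \<Rightarrow> nat" where "\<delta> e = (if e = i then 1 else 0)" for e
  have "x $ i = homogeneous_polynomial 1 (\<lambda>\<nu>. if \<nu> = \<delta> then 1 else 0) x" for x :: "real^'a"
  proof -
    have "multi_degree \<delta> = 1"
      by (simp add: multi_degree_def \<delta>_def)
    then have "homogeneous_polynomial 1 (\<lambda>\<nu>. if \<nu> = \<delta> then 1 else 0) x = monomial x \<delta>"
      by (simp add: homogeneous_polynomial_def if_distrib[of "\<lambda>t. _ * t"] finite_multi_degree cong: if_cong)
    also have "\<dots> = (\<Prod>e\<in>UNIV. if e = i then x $ e else 1)"
      unfolding monomial_def \<delta>_def by (intro prod.cong) auto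
    finally show ?thesis
      by simp
  qed
  then show ?thesis
    unfolding hom_majorized_def by (intro exI[of _ "\<lambda>\<nu>. if \<nu> = \<delta> then 1 else 0"]) auto
qed

text \<open>The coefficients of the product of two polynomials, by convolution.\<close>

lemma homogeneous_polynomial_mult:
  fixes b c :: "('m::finite \<Rightarrow> nat) \<Rightarrow> real"
  shows "homogeneous_polynomial d b x * homogeneous_polynomial d' c x =
    homogeneous_polynomial (d + d')
      (\<lambda>\<nu>. \<Sum>(\<mu>, \<kappa>) | multi_degree \<mu> = d \<and> multi_degree \<kappa> = d' \<and> (\<lambda>e. \<mu> e + \<kappa> e) = \<nu>. b \<mu> * c \<kappa>) x"
proof -
  let ?M = "\<lambda>d. {\<nu> :: 'm \<Rightarrow> nat. multi_degree \<nu> = d}"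
  let ?g = "\<lambda>(\<mu>, \<kappa>). (\<lambda>e. \<mu> e + \<kappa> e) :: 'm \<Rightarrow> nat"
  let ?h = "\<lambda>(\<mu>, \<kappa>). monomial x \<mu> * b \<mu> * (monomial x \<kappa> * c \<kappa>)"
  have "homogeneous_polynomial d b x * homogeneous_polynomial d' c x = sum ?h (?M d \<times> ?M d')"
    by (simp add: homogeneous_polynomial_def sum_product sum.cartesian_product)
  also have "\<dots> = (\<Sum>\<nu>\<in>?M (d + d'). sum ?h {p \<in> ?M d \<times> ?M d'. ?g p = \<nu>})"
    by (intro sum.group[symmetric] finite_cartesian_product finite_multi_degree)
      (auto simp: multi_degree_add)
  also have "\<dots> = (\<Sum>\<nu>\<in>?M (d + d'). monomial x \<nu> *
      (\<Sum>(\<mu>, \<kappa>) | multi_degree \<mu> = d \<and> multi_degree \<kappa> = d' \<and> (\<lambda>e. \<mu> e + \<kappa> e) = \<nu>. b \<mu> * c \<kappa>))"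
    unfolding sum_distrib_left
    by (intro sum.cong refl) (auto simp: monomial_add mult_ac)
  finally show ?thesis
    by (simp add: homogeneous_polynomial_def)
qed

lemma hom_majorized_mult:
  assumes "hom_majorized d f F" "hom_majorized d' g G"
  shows "hom_majorized (d + d') (\<lambda>x. f x * g x) (\<lambda>x. F x * G x)"
proof -
  obtain c C where 1: "\<And>x. f x = homogeneous_polynomial d c x" "\<And>x. F x = homogeneous_polynomial d C x"
    "\<And>\<nu>. \<bar>c \<nu>\<bar> \<le> C \<nu>"
    using assms(1) by (auto simp: hom_majorized_def)
  obtain b D where 2: "\<And>x. g x = homogeneous_polynomial d' b x" "\<And>x. G x = homogeneous_polynomial d' D x"
    "\<And>\<nu>. \<bar>b \<nu>\<bar> \<le> D \<nu>"
    using assms(2) by (auto simp: hom_majorized_def)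
  have le: "\<bar>\<Sum>(\<mu>, \<kappa>)\<in>S. c \<mu> * b \<kappa>\<bar> \<le> (\<Sum>(\<mu>, \<kappa>)\<in>S. C \<mu> * D \<kappa>)" for S
  proof (rule order_trans[OF sum_abs sum_mono], clarify)
    fix \<mu> \<kappa>
    have "0 \<le> C \<mu>"
      using 1(3)[of \<mu>] by linarith
    then show "\<bar>c \<mu> * b \<kappa>\<bar> \<le> C \<mu> * D \<kappa>"
      using 1(3)[of \<mu>] 2(3)[of \<kappa>] by (simp add: abs_mult mult_mono)
  qed
  let ?S = "\<lambda>\<nu>. {(\<mu>, \<kappa>). multi_degree \<mu> = d \<and> multi_degree \<kappa> = d' \<and> (\<lambda>e. \<mu> e + \<kappa> e) = \<nu>}"
  show ?thesis
    unfolding hom_majorized_def 1 2 homogeneous_polynomial_mult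
    by (rule exI[of _ "\<lambda>\<nu>. \<Sum>(\<mu>, \<kappa>)\<in>?S \<nu>. c \<mu> * b \<kappa>"],
        rule exI[of _ "\<lambda>\<nu>. \<Sum>(\<mu>, \<kappa>)\<in>?S \<nu>. C \<mu> * D \<kappa>"]) (blast intro: le)
qed

lemma hom_majorized_prod_list:
  assumes "\<And>\<alpha>. \<alpha> \<in> set \<alpha>s \<Longrightarrow> hom_majorized \<alpha> (f \<alpha>) (F \<alpha>)"
  shows "hom_majorized (sum_list \<alpha>s) (\<lambda>x. prod_list (map (\<lambda>\<alpha>. f \<alpha> x) \<alpha>s)) (\<lambda>x. prod_list (map (\<lambda>\<alpha>. F \<alpha> x) \<alpha>s))"
  using assms by (induction \<alpha>s) (auto intro: hom_majorized_one hom_majorized_mult)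

text \<open>The entrywise absolute value.\<close>

definition abs_matrix :: "real^'n^'m \<Rightarrow> real^'n^'m" where
  "abs_matrix P = (\<chi> i j. \<bar>P $ i $ j\<bar>)"

text \<open>The sign in the recursion turns \<open>- abs_matrix P\<close> into a matrix with nonnegative entries.\<close>

lemma series_term_hom_majorized:
  "hom_majorized n (\<lambda>x. series_term P n x $ i) (\<lambda>x. series_term (- abs_matrix P) n x $ i)"
proof (induction n arbitrary: i rule: less_induct)
  case (less n)
  let ?T = "\<lambda>P x j k. arcsin_coeff k *
     (\<Sum>\<alpha>s\<in>odd_tuples (2 * k + 1) n. prod_list (map (\<lambda>\<alpha>. series_term P \<alpha> x $ j) \<alpha>s))"
  have T: "hom_majorized n (\<lambda>x. ?T P x j k) (\<lambda>x. ?T (- abs_matrix P) x j k)" if "k \<in> {1..n}" for j k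
  proof -
    have "hom_majorized n (\<lambda>x. prod_list (map (\<lambda>\<alpha>. series_term P \<alpha> x $ j) \<alpha>s))
      (\<lambda>x. prod_list (map (\<lambda>\<alpha>. series_term (- abs_matrix P) \<alpha> x $ j) \<alpha>s))"
      if "\<alpha>s \<in> odd_tuples (2 * k + 1) n" for \<alpha>s
    proof -
      have "hom_majorized (sum_list \<alpha>s) (\<lambda>x. prod_list (map (\<lambda>\<alpha>. series_term P \<alpha> x $ j) \<alpha>s))
          (\<lambda>x. prod_list (map (\<lambda>\<alpha>. series_term (- abs_matrix P) \<alpha> x $ j) \<alpha>s))"
        using odd_tuples_less[of k \<alpha>s n] \<open>k \<in> {1..n}\<close> that
        by (intro hom_majorized_prod_list less.IH) auto
      moreover have "sum_list \<alpha>s = n"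
        using that by (simp add: odd_tuples_def)
      ultimately show ?thesis
        by simp
    qed
    then have "hom_majorized n (\<lambda>x. ?T P x j k) (\<lambda>x. \<bar>arcsin_coeff k\<bar> *
        (\<Sum>\<alpha>s\<in>odd_tuples (2 * k + 1) n.
          prod_list (map (\<lambda>\<alpha>. series_term (- abs_matrix P) \<alpha> x $ j) \<alpha>s)))"
      by (intro hom_majorized_scale hom_majorized_sum)
    then show ?thesis
      using arcsin_coeff_pos[of k] by simp
  qed
  have "hom_majorized n (\<lambda>x. (if n = 1 then x $ i else 0) + (\<Sum>j\<in>UNIV. (- P $ i $ j) * (\<Sum>k=1..n. ?T P x j k)))
    (\<lambda>x. (if n = 1 then x $ i else 0) + (\<Sum>j\<in>UNIV. \<bar>- P $ i $ j\<bar> * (\<Sum>k=1..n. ?T (- abs_matrix P) x j k)))"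
  proof (intro hom_majorized_add hom_majorized_sum hom_majorized_scale T)
    show "hom_majorized n (\<lambda>x. if n = 1 then x $ i else 0) (\<lambda>x. if n = 1 then x $ i else 0)"
      using hom_majorized_coordinate[of i] hom_majorized_zero[of n] by (cases "n = 1") simp_all
  qed
  moreover have "series_term P n x $ i =
      (if n = 1 then x $ i else 0) + (\<Sum>j\<in>UNIV. (- P $ i $ j) * (\<Sum>k=1..n. ?T P x j k))" for x
    by (subst series_term_nth) (simp only: mult_minus_left sum_negf diff_conv_add_uminus)
  moreover have "series_term (- abs_matrix P) n x $ i =
      (if n = 1 then x $ i else 0) + (\<Sum>j\<in>UNIV. \<bar>- P $ i $ j\<bar> * (\<Sum>k=1..n. ?T (- abs_matrix P) x j k))" for x
    by (subst series_term_nth)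
      (simp only: abs_matrix_def vector_uminus_component vec_lambda_beta abs_minus_cancel
        mult_minus_left sum_negf diff_minus_eq_add)
  ultimately show ?case
    by (simp only:)
qed

section \<open>Absolute convergence over the multi-indices\<close>

text \<open>A sum over a graded index set can be evaluated degree by degree if it is dominated.\<close>

lemma has_sum_graded:
  fixes f :: "'i \<Rightarrow> complex" and F :: "'i \<Rightarrow> real" and deg :: "'i \<Rightarrow> nat"
  assumes fin: "\<And>d. finite {\<nu>. deg \<nu> = d}"
    and le: "\<And>\<nu>. norm (f \<nu>) \<le> F \<nu>"
    and summable: "summable (\<lambda>d. \<Sum>\<nu> | deg \<nu> = d. F \<nu>)"
    and sums: "(\<lambda>d. \<Sum>\<nu> | deg \<nu> = d. f \<nu>) sums s"
  shows "(f has_sum s) UNIV"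
proof -
  have F: "0 \<le> F \<nu>" for \<nu>
    using le[of \<nu>] norm_ge_zero order_trans by blast
  have Un: "{\<nu>. deg \<nu> < n} = (\<Union>d\<in>{..<n}. {\<nu>. deg \<nu> = d})" for n
    by auto
  have fin': "finite {\<nu>. deg \<nu> < n}" for n
    unfolding Un using fin by blast
  have upto: "sum g {\<nu>. deg \<nu> < n} = (\<Sum>d<n. \<Sum>\<nu> | deg \<nu> = d. g \<nu>)" for n and g :: "'i \<Rightarrow> 'b::comm_monoid_add"
    unfolding Un using fin by (intro sum.UNION_disjoint) auto
  have "sum F X \<le> (\<Sum>d. \<Sum>\<nu> | deg \<nu> = d. F \<nu>)" if X: "finite X" for X
  proof -
    obtain n where "deg ` X \<subseteq> {..<n}"
      using finite_nat_bounded[OF finite_imageI[OF X]] by blast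
    then have "X \<subseteq> {\<nu>. deg \<nu> < n}"
      by auto
    then have "sum F X \<le> sum F {\<nu>. deg \<nu> < n}"
      using F fin' by (intro sum_mono2) auto
    also have "\<dots> \<le> (\<Sum>d. \<Sum>\<nu> | deg \<nu> = d. F \<nu>)"
      unfolding upto using summable F by (intro sum_le_suminf) (auto intro: sum_nonneg)
    finally show ?thesis .
  qed
  then have "F summable_on UNIV"
    using F by (intro nonneg_bdd_above_summable_on bdd_aboveI[of _ "\<Sum>d. \<Sum>\<nu> | deg \<nu> = d. F \<nu>"]) auto
  then have "(\<lambda>\<nu>. norm (f \<nu>)) summable_on UNIV"
    by (rule Infinite_Sum.abs_summable_on_comparison_test') (rule le)
  then have "f summable_on UNIV"
    by (rule abs_summable_summable)
  then have "(f has_sum infsum f UNIV) UNIV"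
    by simp
  then have "(sum f \<longlongrightarrow> infsum f UNIV) (finite_subsets_at_top UNIV)"
    by (simp add: has_sum_def)
  moreover have "filterlim (\<lambda>n. {\<nu>. deg \<nu> < n}) (finite_subsets_at_top UNIV) sequentially"
    unfolding filterlim_finite_subsets_at_top
  proof (intro allI impI)
    fix X :: "'i set"
    assume "finite X \<and> X \<subseteq> UNIV"
    then obtain n where n: "deg ` X \<subseteq> {..<n}"
      using finite_nat_bounded[of "deg ` X"] by blast
    show "\<forall>\<^sub>F n in sequentially. finite {\<nu>. deg \<nu> < n} \<and> X \<subseteq> {\<nu>. deg \<nu> < n} \<and> {\<nu>. deg \<nu> < n} \<subseteq> UNIV"
      using eventually_ge_at_top[of n] by eventually_elim (use n fin' in fastforce)
  qed
  ultimately have "(\<lambda>n. sum f {\<nu>. deg \<nu> < n}) \<longlonglongrightarrow> infsum f UNIV"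
    by (rule filterlim_compose)
  then have "(\<lambda>d. \<Sum>\<nu> | deg \<nu> = d. f \<nu>) sums infsum f UNIV"
    by (simp add: sums_def upto)
  with sums have "infsum f UNIV = s"
    by (rule sums_unique2[symmetric])
  with \<open>(f has_sum infsum f UNIV) UNIV\<close> show ?thesis
    by simp
qed

lemma sums_vec:
  fixes f :: "nat \<Rightarrow> 'a::real_normed_vector^'m"
  assumes "\<And>e. (\<lambda>n. f n $ e) sums (s $ e)"
  shows "f sums s"
  using assms unfolding sums_def by (intro vec_tendstoI) simp

lemma strongly_sumsI:
  fixes c :: "('m::finite \<Rightarrow> nat) \<Rightarrow> 'a::real_normed_vector^'k"
  assumes "\<And>e. ((\<lambda>\<nu>. monomial (x - x0) \<nu> *\<^sub>R c \<nu> $ e) has_sum (s $ e)) UNIV"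
  shows "strongly_sums c x0 x s"
  unfolding strongly_sums_def
proof (intro allI impI sums_vec)
  fix \<sigma> :: "nat \<Rightarrow> 'm \<Rightarrow> nat" and e
  assume "bij \<sigma>"
  from has_sum_imp_sums[OF has_sum_reindex_bij_betw[OF this, THEN iffD2, OF assms]]
  show "(\<lambda>k. (monomial (x - x0) (\<sigma> k) *\<^sub>R c (\<sigma> k)) $ e) sums (s $ e)"
    by simp
qed

lemma odd_terms_sums:
  assumes "f sums s" "\<And>n. even n \<Longrightarrow> f n = 0"
  shows "(\<lambda>i. f (2 * i + 1)) sums s"
proof (subst sums_mono_reindex)
  show "f n = 0" if "n \<notin> range (\<lambda>i. 2 * i + 1)" for n
    using that assms(2) by (metis oddE rangeI)
qed (use assms(1) in \<open>auto simp: strict_mono_def\<close>)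

context edge_balance_contraction
begin

text \<open>The locale is used a second time, for the matrix \<open>- abs_matrix P\<close> at the point \<open>(\<bar>\<eta>\<^sub>e\<bar>)\<close>.\<close>

lemma strongly_sums_inv_map:
  obtains c :: "('m \<Rightarrow> nat) \<Rightarrow> real^'m" where
    "\<And>n x. series_term P n x = homogeneous_polynomial n c x"
    "\<And>\<nu>. even (multi_degree \<nu>) \<Longrightarrow> c \<nu> = 0"
    "\<And>\<eta>. vec_norm_inf \<eta> < radius \<Longrightarrow> strongly_sums (\<lambda>\<nu>. cvec (c \<nu>)) 0 \<eta> (inv_map (cvec \<eta>))"
proof -
  interpret majorant: edge_balance_contraction "- abs_matrix P" N R
    using row_sum R_pos R_less_1 contraction by unfold_locales (auto simp: abs_matrix_def)
  obtain b C where bC: "\<And>n i x. series_term P n x $ i = homogeneous_polynomial n (b n i) x"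
    "\<And>n i x. series_term (- abs_matrix P) n x $ i = homogeneous_polynomial n (C n i) x"
    "\<And>n i \<nu>. \<bar>b n i \<nu>\<bar> \<le> C n i \<nu>"
    using series_term_hom_majorized[of _ P] unfolding hom_majorized_def by metis
  define c where "c \<nu> = (\<chi> i. if even (multi_degree \<nu>) then 0 else b (multi_degree \<nu>) i \<nu>)" for \<nu>
  have c: "series_term P n x = homogeneous_polynomial n c x" for n x
  proof (cases "even n")
    case True
    then show ?thesis
      by (simp add: series_term_even homogeneous_polynomial_def c_def vec_eq_iff)
  next
    case False
    then show ?thesis
      by (auto simp: vec_eq_iff bC(1) homogeneous_polynomial_nth c_def intro!: homogeneous_polynomial_cong)
  qed
  moreover have "c \<nu> = 0" if "even (multi_degree \<nu>)" for \<nu>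
    using that by (simp add: c_def vec_eq_iff)
  moreover have "strongly_sums (\<lambda>\<nu>. cvec (c \<nu>)) 0 \<eta> (inv_map (cvec \<eta>))" if \<eta>: "vec_norm_inf \<eta> < radius" for \<eta>
  proof (rule strongly_sumsI, rule has_sum_graded)
    fix e
    define \<eta>' where "\<eta>' = (\<chi> e. \<bar>\<eta> $ e\<bar>)"
    define F where "F \<nu> = monomial \<eta>' \<nu> * C (multi_degree \<nu>) e \<nu>" for \<nu>
    show "finite {\<nu> :: 'm \<Rightarrow> nat. multi_degree \<nu> = d}" for d
      by (rule finite_multi_degree)
    show "norm (monomial (\<eta> - 0) \<nu> *\<^sub>R cvec (c \<nu>) $ e) \<le> F \<nu>" for \<nu>
    proof -
      have "\<bar>c \<nu> $ e\<bar> \<le> C (multi_degree \<nu>) e \<nu>"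
        using bC(3)[of "multi_degree \<nu>" e \<nu>] by (auto simp: c_def)
      moreover have "\<bar>monomial \<eta> \<nu>\<bar> = monomial \<eta>' \<nu>"
        by (simp add: \<eta>'_def abs_monomial)
      ultimately show ?thesis
        using abs_ge_zero[of "monomial \<eta> \<nu>"] by (simp add: F_def cvec_def mult_left_mono)
    qed
    have "vec_norm_inf \<eta>' = vec_norm_inf \<eta>"
      by (rule vec_norm_inf_cong) (simp add: \<eta>'_def)
    then have "(\<lambda>n. complex_of_real (series_term (- abs_matrix P) n \<eta>' $ e)) sums
        (majorant.inv_map (cvec \<eta>') $ e)"
      using \<eta> by (intro majorant.series_term_sums_inv_map) simp
    then have "summable (\<lambda>n. series_term (- abs_matrix P) n \<eta>' $ e)"
      using sums_summable summable_complex_of_real by blast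
    then show "summable (\<lambda>d. \<Sum>\<nu> | multi_degree \<nu> = d. F \<nu>)"
      by (simp add: bC(2) F_def homogeneous_polynomial_def)
    have "(\<Sum>\<nu> | multi_degree \<nu> = d. monomial (\<eta> - 0) \<nu> *\<^sub>R cvec (c \<nu>) $ e) =
        of_real (series_term P d \<eta> $ e)" for d
      unfolding c homogeneous_polynomial_nth
      by (simp add: homogeneous_polynomial_def cvec_def scaleR_conv_of_real)
    then show "(\<lambda>d. \<Sum>\<nu> | multi_degree \<nu> = d. monomial (\<eta> - 0) \<nu> *\<^sub>R cvec (c \<nu>) $ e) sums (inv_map (cvec \<eta>) $ e)"
      using series_term_sums_inv_map[OF \<eta>] by simp
  qed
  ultimately show ?thesis
    by (rule that)
qed

end

section \<open>The edge balance map of a graph\<close>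

text \<open>On the open unit polydisk, where the series of the arcsine converges.\<close>

lemma edge_balance_eq:
  fixes Pcut Pcyc :: "real^'a^'a"
  assumes "Pcut + Pcyc = mat 1" "vec_norm_inf \<phi> < 1"
  shows "edge_balance Pcut Pcyc \<phi> = \<phi> + cmat Pcyc *v (\<chi> e. arcsin_tail (\<phi> $ e))"
proof -
  have "(\<chi> e. arcsin_series (\<phi> $ e)) = \<phi> + (\<chi> e. arcsin_tail (\<phi> $ e))"
    using assms(2) by (simp add: vec_eq_iff vec_norm_inf_less_iff arcsin_series_eq)
  then have "edge_balance Pcut Pcyc \<phi> =
      (cmat Pcut + cmat Pcyc) *v \<phi> + cmat Pcyc *v (\<chi> e. arcsin_tail (\<phi> $ e))"
    by (simp add: edge_balance_def matrix_vector_right_distrib matrix_vector_mult_add_rdistrib)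
  moreover have "cmat Pcut + cmat Pcyc = cmat (Pcut + Pcyc)"
    by (simp add: cmat_def vec_eq_iff)
  moreover have "cmat (mat 1 :: real^'a^'a) = mat 1"
    by (simp add: cmat_def mat_def vec_eq_iff)
  ultimately show ?thesis
    using assms(1) by simp
qed

theorem theorem5p1:
  fixes E :: "'n::finite set set" and a :: "'n \<Rightarrow> 'n \<Rightarrow> real"
    and src tgt :: "'m::finite \<Rightarrow> 'n"
    and B :: "real^'m^'n" and W Pcut Pcyc :: "real^'m^'m"
    and \<eta> :: "real^'m" and \<gamma> :: real
    and F :: "complex^'m \<Rightarrow> complex^'m" and D V D\<eta> :: "(complex^'m) set"
    and A :: "nat \<Rightarrow> real^'m \<Rightarrow> real^'m"
  assumes "weighted_graph E a" and "connected_graph E" and "edge_orientation E src tgt"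
    and "B = incidence_matrix src tgt" and "W = weight_matrix a src tgt"
    and "Pcut = cutset_projection B W" and "Pcyc = cycle_projection B W"
    and "vec_norm_inf \<eta> < h (mat_norm_inf Pcyc)"
    and "\<gamma> = gamma_star (vec_norm_inf \<eta>)"
    and "F = edge_balance Pcut Pcyc"
    and "D = polydisk 0 (sin \<gamma>)"
    and "D\<eta> = polydisk 0 (vec_norm_inf \<eta>)"
    and "V = {\<phi> \<in> D. F \<phi> \<in> D\<eta>}"
    and "A = series_term Pcyc"
  shows "0 \<le> \<gamma> \<and> \<gamma> < pi / 2 \<and>
    (\<exists>!\<phi>. \<phi> \<in> D \<and> F \<phi> = cvec \<eta>) \<and>
    (\<exists>Finv :: complex^'m \<Rightarrow> complex^'m.
       Finv ` D\<eta> \<subseteq> V \<and> holomorphic_vec_on Finv D\<eta> \<and>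
       (\<forall>\<phi>\<in>V. Finv (F \<phi>) = \<phi>) \<and>
       (\<forall>\<xi>\<in>D\<eta>. F (Finv \<xi>) = \<xi>) \<and>
       (\<exists>c :: ('m \<Rightarrow> nat) \<Rightarrow> real^'m.
          (\<forall>i x. A (2 * i + 1) x = homogeneous_polynomial (2 * i + 1) c x) \<and>
          (\<forall>\<nu>. even (multi_degree \<nu>) \<longrightarrow> c \<nu> = 0) \<and>
          (\<lambda>i. cvec (A (2 * i + 1) \<eta>)) sums Finv (cvec \<eta>) \<and>
          strongly_sums (\<lambda>\<nu>. cvec (c \<nu>)) 0 \<eta> (Finv (cvec \<eta>))))"
proof -
  define N where "N = mat_norm_inf Pcyc"
  define s where "s = vec_norm_inf \<eta>"
  \<comment> \<open>For \<open>\<eta> = 0\<close> the polydisk of radius \<open>sin \<gamma>\<close> is a single point; the inverse is then taken on a larger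
    one, which belongs to an arbitrary value in the range \<open>{0<..<h N}\<close>.\<close>
  define r where "r = (if s = 0 then h N / 2 else s)"
  define R where "R = sin (gamma_star r)"
  have row_sum: "(\<Sum>j\<in>UNIV. \<bar>Pcyc $ i $ j\<bar>) \<le> N" for i
    unfolding N_def by (rule row_sum_le_mat_norm_inf)
  then have N: "0 \<le> N"
    by (rule order_trans[rotated]) (simp add: sum_nonneg)
  have s: "0 \<le> s" "s < h N"
    using assms(8) vec_norm_inf_nonneg by (auto simp: s_def N_def)
  then have r: "0 < r" "r < h N" "s \<le> r"
    by (auto simp: r_def)
  note \<gamma>r = gamma_star_properties[OF N r(1,2)]
  have "cos (gamma_star r) > 0"
    using \<gamma>r(1,2) by (intro cos_gt_zero) auto
  moreover have "0 < R" "R < 1"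
    unfolding R_def using \<gamma>r(1,2) sin_monotone_2pi[of "gamma_star r" "pi / 2"] by (auto intro!: sin_gt_zero)
  moreover have "sqrt (1 - R\<^sup>2) = cos (gamma_star r)"
    using \<open>cos (gamma_star r) > 0\<close> by (simp add: R_def cos_squared_eq[symmetric])
  ultimately interpret edge_balance_contraction Pcyc N R
    using row_sum \<gamma>r(3) by unfold_locales auto
  have "arcsin R = gamma_star r"
    unfolding R_def using \<gamma>r(1,2) by (intro arcsin_sin) auto
  then have s_radius: "s < radius"
    using \<gamma>r(4) r(3) unfolding radius_def by (simp add: R_def)
  have \<gamma>: "0 \<le> \<gamma>" "\<gamma> < pi / 2"
    using assms(9) \<gamma>r(1,2) by (auto simp: gamma_star_def r_def s_def split: if_splits)
  have D: "\<phi> \<in> D \<longleftrightarrow> vec_norm_inf \<phi> \<le> sin \<gamma>" and D\<eta>: "\<phi> \<in> D\<eta> \<longleftrightarrow> vec_norm_inf \<phi> \<le> s" for \<phi>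
    by (auto simp: assms(11,12) mem_polydisk_0 s_def)
  have sin_le: "sin \<gamma> \<le> R"
    using assms(9) R_pos by (auto simp: r_def s_def R_def gamma_star_def)
  have F: "F \<phi> = \<phi> + tail \<phi>" if "vec_norm_inf \<phi> \<le> R" for \<phi>
    unfolding assms(10) tail_def using that R_less_1
    by (intro edge_balance_eq) (auto simp: assms(6,7) cycle_projection_def)
  have inv: "vec_norm_inf (inv_map \<xi>) \<le> R" "F (inv_map \<xi>) = \<xi>" if "\<xi> \<in> D\<eta>" for \<xi>
    using inv_map[of \<xi>] that s_radius F[of "inv_map \<xi>"] by (auto simp: D\<eta>)
  have inv_F: "inv_map (F \<phi>) = \<phi>" if "vec_norm_inf \<phi> \<le> R" "F \<phi> \<in> D\<eta>" for \<phi>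
    using that s_radius F[OF that(1)] by (intro inv_map_eqI) (auto simp: D\<eta>)
  have inv_D: "inv_map \<xi> \<in> D" if "\<xi> \<in> D\<eta>" for \<xi>
  proof (cases "s = 0")
    case True
    have "F 0 = 0"
      using R_pos by (subst F) (auto simp: vec_norm_inf_le_iff tail_0)
    moreover have "\<xi> = 0"
      using that True vec_norm_inf_nonneg[of \<xi>] by (simp add: D\<eta> flip: vec_norm_inf_eq_0_iff)
    ultimately have "inv_map \<xi> = 0"
      using inv_F[of 0] that R_pos by (simp add: vec_norm_inf_le_iff)
    then show ?thesis
      using \<gamma> by (auto simp: D vec_norm_inf_le_iff intro!: sin_ge_zero)
  next
    case False
    then have "sin \<gamma> = R"
      by (simp add: assms(9) R_def r_def s_def)
    then show ?thesis
      using inv(1)[OF that] by (simp add: D)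
  qed
  have \<eta>: "cvec \<eta> \<in> D\<eta>"
    by (simp add: D\<eta> s_def vec_norm_inf_cvec)
  obtain c :: "('m \<Rightarrow> nat) \<Rightarrow> real^'m" where c:
    "\<And>n x. series_term Pcyc n x = homogeneous_polynomial n c x"
    "\<And>\<nu>. even (multi_degree \<nu>) \<Longrightarrow> c \<nu> = 0"
    "\<And>\<eta>. vec_norm_inf \<eta> < radius \<Longrightarrow> strongly_sums (\<lambda>\<nu>. cvec (c \<nu>)) 0 \<eta> (inv_map (cvec \<eta>))"
    using strongly_sums_inv_map by blast
  have "\<exists>!\<phi>. \<phi> \<in> D \<and> F \<phi> = cvec \<eta>"
  proof (rule ex1I[of _ "inv_map (cvec \<eta>)"])
    show "inv_map (cvec \<eta>) \<in> D \<and> F (inv_map (cvec \<eta>)) = cvec \<eta>"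
      using inv_D inv \<eta> by simp
    show "\<phi> = inv_map (cvec \<eta>)" if "\<phi> \<in> D \<and> F \<phi> = cvec \<eta>" for \<phi>
      using that inv_F[of \<phi>] \<eta> sin_le by (auto simp: D)
  qed
  moreover have "inv_map ` D\<eta> \<subseteq> V"
    using inv_D inv(2) by (auto simp: assms(13))
  moreover have "holomorphic_vec_on inv_map D\<eta>"
    unfolding holomorphic_vec_on_def
  proof (rule exI[of _ "{\<xi>. vec_norm_inf \<xi> < radius}"], rule exI[of _ inv_map], intro conjI ballI)
    show "open {\<xi> :: complex^'m. vec_norm_inf \<xi> < radius}"
      by (rule open_domain)
    show "D\<eta> \<subseteq> {\<xi>. vec_norm_inf \<xi> < radius}"
      using s_radius by (auto simp: D\<eta>)
    show "\<exists>J :: complex^'m^'m. (inv_map has_derivative (\<lambda>v. J *v v)) (at \<xi>)"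
      if "\<xi> \<in> {\<xi>. vec_norm_inf \<xi> < radius}" for \<xi>
      using that has_derivative_inv_map[of \<xi>] by blast
  qed simp
  moreover have "\<forall>\<phi>\<in>V. inv_map (F \<phi>) = \<phi>"
    using inv_F sin_le by (auto simp: assms(13) D)
  moreover have "\<forall>\<xi>\<in>D\<eta>. F (inv_map \<xi>) = \<xi>"
    using inv(2) by blast
  moreover have "(\<lambda>i. cvec (A (2 * i + 1) \<eta>)) sums inv_map (cvec \<eta>)"
  proof (rule sums_vec)
    fix e
    have "(\<lambda>n. of_real (series_term Pcyc n \<eta> $ e)) sums (inv_map (cvec \<eta>) $ e)"
      using s_radius by (intro series_term_sums_inv_map) (simp add: s_def)
    from odd_terms_sums[OF this]
    show "(\<lambda>i. cvec (A (2 * i + 1) \<eta>) $ e) sums (inv_map (cvec \<eta>) $ e)"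
      by (simp add: series_term_even cvec_def assms(14))
  qed
  moreover have "strongly_sums (\<lambda>\<nu>. cvec (c \<nu>)) 0 \<eta> (inv_map (cvec \<eta>))"
    using s_radius by (intro c(3)) (simp add: s_def)
  ultimately show ?thesis
    using \<gamma> c(1,2) unfolding assms(14)
    by (intro conjI exI[of _ inv_map] exI[of _ c]) simp_all
qed

end
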